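(* Let $\rho$ be a probability distribution on $\mathcal S$, let $\pi^*$ be an optimal robust policy, and let $$M=\sup_{u\in\mathcal U}\Big\|\frac{d_\rho^{\pi^*,u}}{\rho}\Big\|_\infty,\qquad M'=\sup_{u,u'\in\mathcal U}\Big\|\frac{d_\rho^{\pi^*,u}}{d_\rho^{\pi^*,u'}}\Big\|_\infty ,$$ assumed finite (they are whenever $\mathrm{supp}(\rho)=\mathcal S$). Let $(\pi_k)$ be generated by the stochastic robust policy mirror descent (SRPMD) method with positive stepsizes satisfying $\eta_k\ge\eta_{k-1}\big(1-\frac{1-\gamma}{M}\big)^{-1}M'$ for all $k\ge1$, and suppose the estimates satisfy $\mathbb E_{\xi_k}\|Q^{\pi_k,\xi_k}_r-Q^{\pi_k}_r\|_\infty\le e_k$ for all $k\ge0$. Then for any iteration $k$, $$\mathbb E\big[f_\rho(\pi_k)-f_\rho(\pi^* )\big]\le\Big(1-\frac{1-\gamma}{M}\Big)^{k}\big(f_\rho(\pi_0)-f_\rho(\pi^* )\big)+\Big(1-\frac{1-\gamma}{M}\Big)^{k-1}\frac{D_w}{M\eta_0}+\frac{4}{1-\gamma}\sum_{t=0}^{k-1}\Big(1-\frac{1-\gamma}{M}\Big)^{k-t-1}e_t .$$ In particular, if $\mathbb E_{\xi_k}\|Q^{\pi_k,\xi_k}_r-Q^{\pi_k}_r\|_\infty\le e$ for all $k\ge0$, then $$\mathbb E\big[f_\rho(\pi_k)-f_\rho(\pi^* )\big]\le\Big(1-\frac{1-\gamma}{M}\Big)^{k}\big(f_\rho(\pi_0)-f_\rho(\pi^*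 )\big)+\Big(1-\frac{1-\gamma}{M}\Big)^{k-1}\frac{D_w}{M\eta_0}+\frac{4Me}{(1-\gamma)^2}.$$
   Context: Robust MDP. $\mathcal S,\mathcal A$ are finite nonempty state and action sets, $c:\mathcal S\times\mathcal A\to\mathbb R$ is a cost with $0<c(s,a)\le1$, $\gamma\in(0,1)$ is the discount factor, and $\mathbb P_{N}$ is a nominal transition kernel ($\mathbb P_N(\cdot|s,a)\in\Delta_{\mathcal S}$, where $\Delta_{\mathcal X}$ is the probability simplex over $\mathcal X$). The uncertainty set $\mathcal U\subset\mathbb R^{|\mathcal S|\times|\mathcal S|\times|\mathcal A|}$ is nonempty, compact and $(s,a)$-rectangular: $\mathcal U=\prod_{s,a}\mathcal U_{s,a}$ with $\mathcal U_{s,a}=\{u(\cdot|s,a):u\in\mathcal U\}$; for every $u\in\mathcal U$, $\mathbb P_u(\cdot|s,a)=\mathbb P_N(\cdot|s,a)+u(\cdot|s,a)$ is a transition kernel. $\Pi$ is the set of stationary randomized policies ($\pi(\cdot|s)\in\Delta_{\mathcal A}$ for all $s$). Values. $V^\pi_u(s)=\mathbb E[\sum_{t\ge0}\gamma^t c(s_t,a_t)\mid s_0=s]$ with $a_t\sim\pi(\cdot|s_t)$, $s_{t+1}\sim\mathbb P_u(\cdot|s_t,a_t)$; $Q^\pi_u(s,a)$ is the same with in addition $a_0=a$. Robust values: $V^\pi_r(s)=\max_{u\in\mathcal U}V^\pi_u(s)$, $Q^\pi_r(s,a)=\max_{u\in\mathcal U}Q^\pi_u(s,a)$. Objective: $f_\rho(\pi)=\mathbb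 E_{s\sim\rho}[V^\pi_r(s)]$. An optimal robust policy $\pi^*$ satisfies $V^{\pi^*}_r(s)\le V^\pi_r(s)$ for all $s\in\mathcal S$, $\pi\in\Pi$ (such a policy exists). Visitation measures: $d^{\pi,u}_s(s')=(1-\gamma)\sum_{t\ge0}\gamma^t\Pr(s_t=s'\mid s_0=s)$ under policy $\pi$ and kernel $\mathbb P_u$; $d^{\pi,u}_\rho(s')=\mathbb E_{s\sim\rho}d^{\pi,u}_s(s')$. Ratios of measures are taken entrywise. SRPMD. Let $w:\mathbb R^{|\mathcal A|}\to\mathbb R$ be strictly convex and $D^{\pi}_{\pi'}(s)=w(\pi(\cdot|s))-w(\pi'(\cdot|s))-\langle\partial w(\pi'(\cdot|s)),\pi(\cdot|s)-\pi'(\cdot|s)\rangle$ the Bregman divergence, where $\partial w(p)$ denotes a subgradient of $w$ at $p$ (when $w$ is not differentiable, the subgradient used at an iterate $\pi_{k+1}(\cdot|s)$ is one for which the first-order optimality condition of the update below holds). Given $\pi_0\in\Pi$ and stepsizes $\eta_k>0$, at iteration $k$ a random estimate $Q^{\pi_k,\xi_k}_r\in\mathbb R^{|\mathcal S||\mathcal A|}$ of $Q^{\pi_k}_r$ is formed from random samples $\xi_k$, and for every $s\in\mathcal S$ $$\pi_{k+1}(\cdot|s)=\operatorname{argmin}_{p(\cdot|s)\in\Delta_{\mathcal A}}\ \eta_k\langle Q^{\pi_k,\xi_k}_r(s,\cdot),p(\cdot|s)\rangle+D^{p}_{\pi_k}(s).$$ $\mathbb E_{\xi_k}$ is expectation over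 $\xi_k$ conditionally on the past ($\pi_k$ given); $\mathbb E$ is over all samples. $D_w=\max_{\pi\in\Pi}\max_{s\in\mathcal S}D^\pi_{\pi_0}(s)$, assumed finite. *)

theory Defs
  imports "HOL-Probability.Probability"
begin

text \<open>
  Conventions. States and actions are finite types \<open>'s\<close> and \<open>'a\<close>. A policy is a vector
  \<open>\<pi> :: real^'a^'s\<close> with \<open>\<pi> $ s $ a\<close> the probability \<open>\<pi>(a|s)\<close>; a transition kernel, and likewise an
  element of the uncertainty set, is a vector \<open>P :: real^'s^'a^'s\<close> with
  \<open>P $ s $ a $ s'\<close> the entry \<open>P(s'|s,a)\<close>. Hence the perturbed kernel is the vector sum \<open>PN + u\<close>.
\<close>

definition prob_simplex :: "(real^'n) set" where
  "prob_simplex = {p. (\<forall>i. 0 \<le> p $ i) \<and> (\<Sum>i\<in>UNIV. p $ i) = 1}"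

definition policies :: "(real^'a^'s) set" where
  "policies = {\<pi>. \<forall>s. \<pi> $ s \<in> prob_simplex}"

definition kernels :: "(real^'s^'a^'s) set" where
  "kernels = {P. \<forall>s a. P $ s $ a \<in> prob_simplex}"

definition rectangular :: "(real^'s^'a^'s) set \<Rightarrow> bool" where
  "rectangular U \<longleftrightarrow> U = {u. \<forall>s a. u $ s $ a \<in> (\<lambda>v. v $ s $ a) ` U}"


section \<open>Trajectories and values\<close>

definition pmf_of_vec :: "real^'n \<Rightarrow> 'n pmf" where
  "pmf_of_vec p = embed_pmf (\<lambda>i. p $ i)"

definition next_pair :: "real^'a^'s \<Rightarrow> real^'s^'a^'s \<Rightarrow> 's \<times> 'a \<Rightarrow> ('s \<times> 'a) pmf" where
  "next_pair \<pi> P sa =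
     bind_pmf (pmf_of_vec (P $ fst sa $ snd sa)) (\<lambda>s'. map_pmf (Pair s') (pmf_of_vec (\<pi> $ s')))"

definition traj_kernel ::
  "('s \<times> 'a) pmf \<Rightarrow> real^'a^'s \<Rightarrow> real^'s^'a^'s \<Rightarrow> nat \<Rightarrow> (nat \<Rightarrow> 's \<times> 'a) \<Rightarrow> ('s \<times> 'a) measure" where
  "traj_kernel \<mu> \<pi> P t \<omega> = measure_pmf (if t = 0 then \<mu> else next_pair \<pi> P (\<omega> (t - 1)))"

lemma Ionescu_Tulcea_traj_kernel:
  fixes \<mu> :: "('s::finite \<times> 'a::finite) pmf"
  shows "Ionescu_Tulcea (traj_kernel \<mu> \<pi> P) (\<lambda>_. count_space UNIV)"
proof (rule Ionescu_Tulcea.intro)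
  fix t :: nat
  show "traj_kernel \<mu> \<pi> P t \<in>
    PiM {0..<t} (\<lambda>_. count_space UNIV) \<rightarrow>\<^sub>M subprob_algebra (count_space UNIV)"
  proof (cases "t = 0")
    case True
    then show ?thesis
      by (simp add: traj_kernel_def[abs_def] measure_pmf_in_subprob_algebra)
  next
    case False
    then have "(\<lambda>\<omega>. \<omega> (t - 1)) \<in>
        PiM {0..<t} (\<lambda>_. count_space UNIV) \<rightarrow>\<^sub>M (count_space UNIV :: ('s \<times> 'a) measure)"
      by (intro measurable_component_singleton) auto
    moreover have "(\<lambda>sa. measure_pmf (next_pair \<pi> P sa)) \<in>
        count_space UNIV \<rightarrow>\<^sub>M subprob_algebra (count_space UNIV)"
      by (simp add: measure_pmf_in_subprob_algebra)
    ultimately have "(\<lambda>\<omega>. measure_pmf (next_pair \<pi> P (\<omega> (t - 1)))) \<in>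
        PiM {0..<t} (\<lambda>_. count_space UNIV) \<rightarrow>\<^sub>M subprob_algebra (count_space UNIV)"
      by (rule measurable_compose)
    with False show ?thesis
      by (simp add: traj_kernel_def[abs_def])
  qed
next
  fix t :: nat and \<omega> :: "nat \<Rightarrow> 's \<times> 'a"
  show "prob_space (traj_kernel \<mu> \<pi> P t \<omega>)"
    by (simp add: traj_kernel_def measure_pmf.prob_space_axioms)
qed

text \<open>The Ionescu-Tulcea measure: the law of \<open>(s\<^sub>t, a\<^sub>t)\<^sub>t\<close> when \<open>(s\<^sub>0, a\<^sub>0)\<close> has law \<open>\<mu>\<close>.\<close>

definition traj_law ::
  "('s \<times> 'a) pmf \<Rightarrow> real^'a^'s \<Rightarrow> real^'s^'a^'s \<Rightarrow> (nat \<Rightarrow> 's \<times> 'a) measure" where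
  "traj_law \<mu> \<pi> P =
     projective_family.lim UNIV
       (Ionescu_Tulcea.CI (traj_kernel \<mu> \<pi> P) (\<lambda>_. count_space UNIV)) (\<lambda>_. count_space UNIV)"

definition start_state :: "real^'a^'s \<Rightarrow> 's \<Rightarrow> ('s \<times> 'a) pmf" where
  "start_state \<pi> s = map_pmf (Pair s) (pmf_of_vec (\<pi> $ s))"

definition disc_cost :: "('s \<Rightarrow> 'a \<Rightarrow> real) \<Rightarrow> real \<Rightarrow> (nat \<Rightarrow> 's \<times> 'a) \<Rightarrow> real" where
  "disc_cost c \<gamma> \<omega> = (\<Sum>t. \<gamma> ^ t * c (fst (\<omega> t)) (snd (\<omega> t)))"

definition V_val ::
  "('s \<Rightarrow> 'a \<Rightarrow> real) \<Rightarrow> real \<Rightarrow> real^'s^'a^'s \<Rightarrow> real^'a^'s \<Rightarrow> 's \<Rightarrow> real" where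
  "V_val c \<gamma> P \<pi> s = (\<integral>\<omega>. disc_cost c \<gamma> \<omega> \<partial>traj_law (start_state \<pi> s) \<pi> P)"

definition Q_val ::
  "('s \<Rightarrow> 'a \<Rightarrow> real) \<Rightarrow> real \<Rightarrow> real^'s^'a^'s \<Rightarrow> real^'a^'s \<Rightarrow> 's \<Rightarrow> 'a \<Rightarrow> real" where
  "Q_val c \<gamma> P \<pi> s a = (\<integral>\<omega>. disc_cost c \<gamma> \<omega> \<partial>traj_law (return_pmf (s, a)) \<pi> P)"

definition V_robust ::
  "('s \<Rightarrow> 'a \<Rightarrow> real) \<Rightarrow> real \<Rightarrow> real^'s^'a^'s \<Rightarrow> (real^'s^'a^'s) set \<Rightarrow> real^'a^'s \<Rightarrow> 's \<Rightarrow> real" where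
  "V_robust c \<gamma> PN U \<pi> s = (SUP u\<in>U. V_val c \<gamma> (PN + u) \<pi> s)"

definition Q_robust ::
  "('s \<Rightarrow> 'a \<Rightarrow> real) \<Rightarrow> real \<Rightarrow> real^'s^'a^'s \<Rightarrow> (real^'s^'a^'s) set \<Rightarrow> real^'a^'s \<Rightarrow> real^'a^'s" where
  "Q_robust c \<gamma> PN U \<pi> = (\<chi> s a. SUP u\<in>U. Q_val c \<gamma> (PN + u) \<pi> s a)"

definition f_obj ::
  "('s \<Rightarrow> 'a \<Rightarrow> real) \<Rightarrow> real \<Rightarrow> real^'s^'a^'s \<Rightarrow> (real^'s^'a^'s) set \<Rightarrow> real^'s \<Rightarrow> real^'a^'s \<Rightarrow> real" where
  "f_obj c \<gamma> PN U \<rho> \<pi> = (\<Sum>s\<in>UNIV. \<rho> $ s * V_robust c \<gamma> PN U \<pi> s)"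

definition optimal_robust ::
  "('s \<Rightarrow> 'a \<Rightarrow> real) \<Rightarrow> real \<Rightarrow> real^'s^'a^'s \<Rightarrow> (real^'s^'a^'s) set \<Rightarrow> real^'a^'s \<Rightarrow> bool" where
  "optimal_robust c \<gamma> PN U \<pi>' \<longleftrightarrow>
     \<pi>' \<in> policies \<and> (\<forall>\<pi>\<in>policies. \<forall>s. V_robust c \<gamma> PN U \<pi>' s \<le> V_robust c \<gamma> PN U \<pi> s)"


section \<open>Visitation measures\<close>

definition visit :: "real \<Rightarrow> real^'s^'a^'s \<Rightarrow> real^'a^'s \<Rightarrow> 's \<Rightarrow> 's \<Rightarrow> real" where
  "visit \<gamma> P \<pi> s s' =
     (1 - \<gamma>) * (\<Sum>t. \<gamma> ^ t * \<P>(\<omega> in traj_law (start_state \<pi> s) \<pi> P. fst (\<omega> t) = s'))"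

definition visit_from :: "real \<Rightarrow> real^'s^'a^'s \<Rightarrow> real^'a^'s \<Rightarrow> real^'s \<Rightarrow> 's \<Rightarrow> real" where
  "visit_from \<gamma> P \<pi> \<rho> s' = (\<Sum>s\<in>UNIV. \<rho> $ s * visit \<gamma> P \<pi> s s')"

text \<open>
  Ratios are formed in \<^typ>\<open>ennreal\<close>, where \<open>x / 0 = \<infinity>\<close> for \<open>x > 0\<close> and \<open>0 / 0 = 0\<close>. Thus finiteness
  of the two suprema below is a genuine condition, whereas real division would make a violation
  of absolute continuity invisible.
\<close>

definition ratio_sup :: "('s \<Rightarrow> real) \<Rightarrow> ('s \<Rightarrow> real) \<Rightarrow> ennreal" where
  "ratio_sup \<mu> \<nu> = (SUP s. ennreal (\<mu> s) / ennreal (\<nu> s))"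

definition mismatch ::
  "real \<Rightarrow> real^'s^'a^'s \<Rightarrow> (real^'s^'a^'s) set \<Rightarrow> real^'a^'s \<Rightarrow> real^'s \<Rightarrow> ennreal" where
  "mismatch \<gamma> PN U \<pi> \<rho> = (SUP u\<in>U. ratio_sup (visit_from \<gamma> (PN + u) \<pi> \<rho>) (\<lambda>s. \<rho> $ s))"

definition mismatch' ::
  "real \<Rightarrow> real^'s^'a^'s \<Rightarrow> (real^'s^'a^'s) set \<Rightarrow> real^'a^'s \<Rightarrow> real^'s \<Rightarrow> ennreal" where
  "mismatch' \<gamma> PN U \<pi> \<rho> =
     (SUP u\<in>U. SUP u'\<in>U. ratio_sup (visit_from \<gamma> (PN + u) \<pi> \<rho>) (visit_from \<gamma> (PN + u') \<pi> \<rho>))"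


section \<open>Stochastic robust policy mirror descent\<close>

definition strictly_convex :: "('v::real_vector \<Rightarrow> real) \<Rightarrow> bool" where
  "strictly_convex w \<longleftrightarrow>
     (\<forall>x y t. x \<noteq> y \<and> 0 < t \<and> t < 1 \<longrightarrow> w ((1 - t) *\<^sub>R x + t *\<^sub>R y) < (1 - t) * w x + t * w y)"

definition is_subgradient :: "('v::real_inner \<Rightarrow> real) \<Rightarrow> 'v \<Rightarrow> 'v \<Rightarrow> bool" where
  "is_subgradient w x g \<longleftrightarrow> (\<forall>y. w x + g \<bullet> (y - x) \<le> w y)"

text \<open>\<open>bregman w g p q\<close> is the divergence of \<open>p\<close> from \<open>q\<close>, with \<open>g\<close> the subgradient of \<open>w\<close> used at \<open>q\<close>.\<close>

definition bregman :: "('v::real_inner \<Rightarrow> real) \<Rightarrow> 'v \<Rightarrow> 'v \<Rightarrow> 'v \<Rightarrow> real" where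
  "bregman w g p q = w p - w q - g \<bullet> (p - q)"

definition bregman_values ::
  "(real^'a \<Rightarrow> real) \<Rightarrow> real^'a^'s \<Rightarrow> real^'a^'s \<Rightarrow> real set" where
  "bregman_values w g \<pi>0 = {bregman w (g $ s) (\<pi> $ s) (\<pi>0 $ s) | \<pi> s. \<pi> \<in> policies}"

text \<open>
  A realization of the method along estimates \<open>Qe k\<close>: \<open>g k $ s\<close> is the subgradient of \<open>w\<close> used at the
  iterate \<open>\<pi> k $ s\<close>. The last conjunct is the first-order optimality condition of the update, which
  selects the subgradient at the new iterate; where \<open>w\<close> is differentiable it follows from the
  argmin property, since the subgradient is then unique.
\<close>

definition srpmd_path ::
  "(real^'a \<Rightarrow> real) \<Rightarrow> (nat \<Rightarrow> real) \<Rightarrow> real^'a^'s \<Rightarrow> real^'a^'s \<Rightarrow>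
    (nat \<Rightarrow> real^'a^'s) \<Rightarrow> (nat \<Rightarrow> real^'a^'s) \<Rightarrow> (nat \<Rightarrow> real^'a^'s) \<Rightarrow> bool" where
  "srpmd_path w \<eta> \<pi>0 g0 Qe \<pi> g \<longleftrightarrow>
     \<pi> 0 = \<pi>0 \<and> g 0 = g0 \<and>
     (\<forall>k s. is_subgradient w (\<pi> k $ s) (g k $ s)) \<and>
     (\<forall>k s. is_arg_min (\<lambda>p. \<eta> k * (Qe k $ s \<bullet> p) + bregman w (g k $ s) p (\<pi> k $ s))
              (\<lambda>p. p \<in> prob_simplex) (\<pi> (Suc k) $ s)) \<and>
     (\<forall>k s. \<forall>p\<in>prob_simplex.
        0 \<le> (\<eta> k *\<^sub>R (Qe k $ s) + g (Suc k) $ s - g k $ s) \<bullet> (p - \<pi> (Suc k) $ s))"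

text \<open>The \<open>\<sigma>\<close>-algebra generated by the samples \<open>\<xi>\<^sub>0, \<dots>, \<xi>\<^sub>k\<^sub>-\<^sub>1\<close>; it is trivial for \<open>k = 0\<close>.\<close>

definition past :: "'w measure \<Rightarrow> (nat \<Rightarrow> 'x measure) \<Rightarrow> (nat \<Rightarrow> 'w \<Rightarrow> 'x) \<Rightarrow> nat \<Rightarrow> 'w measure" where
  "past \<Omega> X \<xi> k = vimage_algebra (space \<Omega>) (\<lambda>\<omega>. \<lambda>i\<in>{..<k}. \<xi> i \<omega>) (PiM {..<k} X)"

text \<open>
  The bound \<open>\<epsilon>\<close> on the conditional expectation of the sup-norm error of the \<open>k\<close>-th estimate given the
  past. Since \<^const>\<open>ennreal\<close> truncates at \<open>0\<close>, nonnegativity of \<open>\<epsilon>\<close>, which the real inequality would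
  force, is explicit. On \<open>real^'a^'s\<close>, \<^const>\<open>infnorm\<close> is the largest absolute value of an entry.
\<close>

definition est_error_le ::
  "'w measure \<Rightarrow> 'w measure \<Rightarrow> ('w \<Rightarrow> real^'a^'s) \<Rightarrow> ('w \<Rightarrow> real^'a^'s) \<Rightarrow> real \<Rightarrow> bool" where
  "est_error_le \<Omega> F Qe Q \<epsilon> \<longleftrightarrow>
     0 \<le> \<epsilon> \<and> (AE \<omega> in \<Omega>. nn_cond_exp \<Omega> F (\<lambda>\<omega>. ennreal (infnorm (Qe \<omega> - Q \<omega>))) \<omega> \<le> ennreal \<epsilon>)"

end

theory Submission
  imports Defs
begin

text \<open>
  Let \<open>G\<close> be the discounted resolvent \<open>b \<mapsto> \<Sum>t. \<gamma>^t T^t b\<close> of the state chain \<open>T\<close> of a policy and a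
  kernel; up to the factor \<open>1 - \<gamma>\<close> it is integration against the visitation measure. By
  rectangularity, one kernel attains the robust value of a policy at all states. Comparing Bellman
  residuals then bounds the difference of the robust values of \<open>\<pi>'\<close> and \<open>\<pi>\<close> by \<open>G\<close> applied to
  \<open>\<langle>Q\<^sub>r\<^sup>\<pi>, \<pi>' - \<pi>\<rangle>\<close>: from above with the worst kernel of \<open>\<pi>'\<close>, from below with that of \<open>\<pi>\<close>.

  The three-point inequality of mirror descent gives \<open>\<langle>Q\<^sub>r, \<pi>\<^sub>k\<^sub>+\<^sub>1 - \<pi>\<^sub>k\<rangle> \<le> 2 \<delta>\<^sub>k\<close> with \<open>\<delta>\<^sub>k\<close> the sup-norm
  error of the estimate. Combined with the two bounds, for \<open>\<pi>' = \<pi>\<^sub>k\<^sub>+\<^sub>1\<close> and \<open>\<pi>' = \<pi>\<^sup>*\<close>, it shows that the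
  gap \<open>f(\<pi>\<^sub>k) - f(\<pi>\<^sup>*)\<close> plus a Bregman potential weighted by the visitation measure of the current
  worst kernel contracts by \<open>1 - (1 - \<gamma>)/M\<close> up to \<open>2 \<delta>\<^sub>k / (1 - \<gamma>)\<close>. Taking expectations needs \<open>\<delta>\<^sub>k\<close> to
  be measurable, which holds since the robust values are Lipschitz in the policy.
\<close>

section \<open>Marginals of the trajectory law\<close>

text \<open>Values and visitation measures depend on \<open>traj_law\<close> only through these laws
  of the pair at a single time, which are finite and obey a one-step recursion.\<close>

primrec marginal :: "('s \<times> 'a) pmf \<Rightarrow> real^'a^'s \<Rightarrow> real^'s^'a^'s \<Rightarrow> nat \<Rightarrow> ('s \<times> 'a) pmf" where
  "marginal \<mu> \<pi> P 0 = \<mu>"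
| "marginal \<mu> \<pi> P (Suc t) = bind_pmf (marginal \<mu> \<pi> P t) (next_pair \<pi> P)"

context
  fixes \<mu> :: "('s::finite \<times> 'a::finite) pmf" and \<pi> :: "real^'a^'s" and P :: "real^'s^'a^'s"
begin

interpretation IT: Ionescu_Tulcea "traj_kernel \<mu> \<pi> P" "\<lambda>_. count_space UNIV"
  by (rule Ionescu_Tulcea_traj_kernel)

text \<open>\<open>IT.C 0 (Suc t)\<close> is the law of the coordinates \<open>0, ..., t\<close>.
  The next kernel sees the path only through coordinate \<open>t\<close>, so integrating out
  coordinate \<open>Suc t\<close> replaces \<open>h\<close> by its \<open>next_pair\<close> average;
  hence the induction over all \<open>h\<close>.\<close>

lemma nn_integral_C_coord:
  fixes h :: "'s \<times> 'a \<Rightarrow> ennreal"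
  shows "(\<integral>\<^sup>+x. h (x t) \<partial>IT.C 0 (Suc t) (\<lambda>_. undefined)) = (\<integral>\<^sup>+y. h y \<partial>marginal \<mu> \<pi> P t)"
proof (induction t arbitrary: h)
  case 0
  have m: "(\<lambda>x. h (x 0)) \<in> borel_measurable (PiM {0..<Suc 0} (\<lambda>_. count_space UNIV))"
    by (rule measurable_compose[OF measurable_component_singleton]) auto
  \<comment> \<open>The path before time 0 is the single point \<open>\<lambda>_. undefined\<close>
    of the empty product, and \<open>C\<close> starts from its Dirac measure.\<close>
  have "IT.C 0 (Suc 0) (\<lambda>_. undefined) = IT.eP 0 (\<lambda>_. undefined)"
    using bind_return[OF IT.measurable_eP[of 0], of "\<lambda>_. undefined"] by (simp add: space_PiM)
  then show ?case
    by (simp only:, subst IT.nn_integral_eP[OF _ m]) (simp_all add: space_PiM traj_kernel_def)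
next
  case (Suc t)
  have m: "(\<lambda>x. h (x (Suc t))) \<in> borel_measurable (PiM {0..<Suc (Suc t)} (\<lambda>_. count_space UNIV))"
    by (rule measurable_compose[OF measurable_component_singleton]) auto
  have sC: "space (IT.C 0 (Suc t) (\<lambda>_. undefined)) = space (PiM {0..<Suc t} (\<lambda>_. count_space UNIV))"
    by (subst IT.space_C) (auto simp: space_PiM)
  have mC: "measurable (IT.C 0 (Suc t) (\<lambda>_. undefined)) N = measurable (PiM {0..<Suc t} (\<lambda>_. count_space UNIV)) N" for N :: "'z measure"
    by (rule measurable_cong_sets) (use IT.sets_C[of "\<lambda>_. undefined" 0 "Suc t"] in \<open>auto simp: space_PiM\<close>)
  have "(\<integral>\<^sup>+x. h (x (Suc t)) \<partial>IT.C 0 (Suc (Suc t)) (\<lambda>_. undefined))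
      = (\<integral>\<^sup>+x. (\<integral>\<^sup>+y. h (y (Suc t)) \<partial>IT.eP (Suc t) x) \<partial>IT.C 0 (Suc t) (\<lambda>_. undefined))"
    by (subst IT.C.simps(2), subst nn_integral_bind[where B="PiM {0..<Suc (Suc t)} (\<lambda>_. count_space UNIV)"])
      (use m IT.measurable_eP[of "Suc t"] in \<open>auto simp: mC simp del: IT.C.simps\<close>)
  also have "\<dots> = (\<integral>\<^sup>+x. (\<integral>\<^sup>+y. h y \<partial>next_pair \<pi> P (x t)) \<partial>IT.C 0 (Suc t) (\<lambda>_. undefined))"
    by (intro nn_integral_cong, subst IT.nn_integral_eP[OF _ m])
      (simp_all add: sC traj_kernel_def del: IT.C.simps)
  also have "\<dots> = (\<integral>\<^sup>+y. h y \<partial>marginal \<mu> \<pi> P (Suc t))"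
    using Suc.IH[of "\<lambda>z. \<integral>\<^sup>+y. h y \<partial>next_pair \<pi> P z"] by (simp del: IT.C.simps)
  finally show ?case .
qed

lemma sets_traj_law: "sets (traj_law \<mu> \<pi> P) = sets (PiM UNIV (\<lambda>_. count_space UNIV))"
  by (simp add: traj_law_def)

lemma measurable_traj_law_coord:
  "(\<lambda>\<omega>. \<omega> t) \<in> traj_law \<mu> \<pi> P \<rightarrow>\<^sub>M count_space UNIV"
  by (subst measurable_cong_sets[OF sets_traj_law refl]) (intro measurable_component_singleton, simp)

text \<open>An event about coordinate \<open>t\<close> is a cylinder over
  \<open>{0..<Suc t}\<close>, and on cylinders the projective limit agrees with the
  finite-dimensional law.\<close>

lemma distr_traj_law_coord:
  "distr (traj_law \<mu> \<pi> P) (count_space UNIV) (\<lambda>\<omega>. \<omega> t) = measure_pmf (marginal \<mu> \<pi> P t)"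
proof (rule measure_eqI)
  fix A :: "('s \<times> 'a) set"
  let ?J = "{0..<Suc t}"
  let ?X = "{x \<in> space (PiM ?J (\<lambda>_. count_space UNIV)). x t \<in> A}"
  have X: "?X \<in> sets (PiM ?J (\<lambda>_. count_space UNIV))"
    by (intro measurable_sets_Collect[OF measurable_component_singleton]) auto
  have "(\<lambda>\<omega>. \<omega> t) -` A \<inter> space (traj_law \<mu> \<pi> P) = prod_emb UNIV (\<lambda>_. count_space UNIV) ?J ?X"
    by (auto simp: traj_law_def prod_emb_def space_PiM)
  then have "emeasure (distr (traj_law \<mu> \<pi> P) (count_space UNIV) (\<lambda>\<omega>. \<omega> t)) A
      = emeasure (traj_law \<mu> \<pi> P) (prod_emb UNIV (\<lambda>_. count_space UNIV) ?J ?X)"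
    by (subst emeasure_distr[OF measurable_traj_law_coord]) auto
  also have "\<dots> = emeasure (IT.CI ?J) ?X"
    unfolding traj_law_def using X by (intro IT.lim) auto
  also have "\<dots> = emeasure (IT.C 0 (Suc t) (\<lambda>_. undefined)) ?X"
    using X by (subst IT.emeasure_CI[where n="Suc t"]) (auto simp: prod_emb_id space_PiM simp del: IT.C.simps)
  also have "\<dots> = (\<integral>\<^sup>+x. indicator A (x t) \<partial>IT.C 0 (Suc t) (\<lambda>_. undefined))"
    by (subst nn_integral_indicator[symmetric])
      (use X IT.sets_C[of "\<lambda>_. undefined" 0 "Suc t"] IT.space_C[of "\<lambda>_. undefined" 0 "Suc t"] in
        \<open>auto simp: space_PiM simp del: IT.C.simps nn_integral_indicator intro!: nn_integral_cong split: split_indicator\<close>)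
  also have "\<dots> = emeasure (marginal \<mu> \<pi> P t) A"
    by (subst nn_integral_C_coord) simp
  finally show "emeasure (distr (traj_law \<mu> \<pi> P) (count_space UNIV) (\<lambda>\<omega>. \<omega> t)) A
      = emeasure (marginal \<mu> \<pi> P t) A" .
qed simp

lemma integral_traj_law_coord:
  fixes f :: "'s \<times> 'a \<Rightarrow> real"
  shows "integrable (traj_law \<mu> \<pi> P) (\<lambda>\<omega>. f (\<omega> t))"
    and "(\<integral>\<omega>. f (\<omega> t) \<partial>traj_law \<mu> \<pi> P) = measure_pmf.expectation (marginal \<mu> \<pi> P t) f"
proof -
  have "integrable (distr (traj_law \<mu> \<pi> P) (count_space UNIV) (\<lambda>\<omega>. \<omega> t)) f"
    unfolding distr_traj_law_coord by (rule integrable_measure_pmf_finite) simp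
  then show "integrable (traj_law \<mu> \<pi> P) (\<lambda>\<omega>. f (\<omega> t))"
    by (rule integrable_distr[OF measurable_traj_law_coord])
  show "(\<integral>\<omega>. f (\<omega> t) \<partial>traj_law \<mu> \<pi> P) = measure_pmf.expectation (marginal \<mu> \<pi> P t) f"
    by (subst distr_traj_law_coord[symmetric], subst integral_distr[OF measurable_traj_law_coord]) auto
qed

lemma prob_traj_law_coord:
  "\<P>(\<omega> in traj_law \<mu> \<pi> P. fst (\<omega> t) = s') =
    measure_pmf.expectation (marginal \<mu> \<pi> P t) (\<lambda>y. indicator {s'} (fst y))"
proof -
  have "(\<integral>\<omega>. indicator {s'} (fst (\<omega> t)) \<partial>traj_law \<mu> \<pi> P) =
      (\<integral>\<omega>. indicator {\<omega>\<in>space (traj_law \<mu> \<pi> P). fst (\<omega> t) = s'} \<omega> \<partial>traj_law \<mu> \<pi> P)"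
    by (intro Bochner_Integration.integral_cong) (auto split: split_indicator)
  also have "\<dots> = measure (traj_law \<mu> \<pi> P) {\<omega>\<in>space (traj_law \<mu> \<pi> P). fst (\<omega> t) = s'}"
    by (simp add: Int_absorb2)
  finally show ?thesis
    using integral_traj_law_coord(2)[of "\<lambda>y. indicator {s'} (fst y)" t] by simp
qed

lemma integral_disc_cost:
  assumes "0 < \<gamma>" "\<gamma> < 1"
  shows "(\<integral>\<omega>. disc_cost c \<gamma> \<omega> \<partial>traj_law \<mu> \<pi> P) =
    (\<Sum>t. \<gamma> ^ t * measure_pmf.expectation (marginal \<mu> \<pi> P t) (\<lambda>y. c (fst y) (snd y)))"
proof -
  \<comment> \<open>With finitely many pairs the cost is bounded, and
    \<open>\<gamma> ^ t * B\<close> dominates the series; this justifies exchanging sum and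
    integral.\<close>
  define B where "B = (\<Sum>y\<in>UNIV. \<bar>c (fst y) (snd y)\<bar>)"
  have B: "\<bar>c (fst y) (snd y)\<bar> \<le> B" for y
    unfolding B_def by (rule member_le_sum) auto
  have int: "integrable (traj_law \<mu> \<pi> P) (\<lambda>\<omega>. \<gamma> ^ t * c (fst (\<omega> t)) (snd (\<omega> t)))" for t
    by (intro integrable_mult_right integral_traj_law_coord(1)[of "\<lambda>y. c (fst y) (snd y)"])
  have "(\<integral>\<omega>. \<bar>\<gamma> ^ t * c (fst (\<omega> t)) (snd (\<omega> t))\<bar> \<partial>traj_law \<mu> \<pi> P) \<le> \<gamma> ^ t * B" for t
  proof -
    have "(\<integral>\<omega>. \<bar>c (fst (\<omega> t)) (snd (\<omega> t))\<bar> \<partial>traj_law \<mu> \<pi> P) \<le> B"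
      unfolding integral_traj_law_coord(2)[of "\<lambda>y. \<bar>c (fst y) (snd y)\<bar>"]
      by (intro measure_pmf.integral_le_const integrable_measure_pmf_finite AE_I2 B) simp
    then show ?thesis
      using assms by (simp add: abs_mult mult_left_mono)
  qed
  moreover have "summable (\<lambda>t. \<gamma> ^ t * B)"
    using assms by (intro summable_mult2 summable_geometric) simp
  ultimately have 1: "summable (\<lambda>t. \<integral>\<omega>. norm (\<gamma> ^ t * c (fst (\<omega> t)) (snd (\<omega> t))) \<partial>traj_law \<mu> \<pi> P)"
    by (elim summable_comparison_test'[where N=0]) (auto simp: integral_nonneg_AE)
  have 2: "summable (\<lambda>t. norm (\<gamma> ^ t * c (fst (\<omega> t)) (snd (\<omega> t))))" for \<omega> :: "nat \<Rightarrow> 's \<times> 'a"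
    using \<open>summable (\<lambda>t. \<gamma> ^ t * B)\<close>
    by (rule summable_comparison_test'[where N=0]) (use assms B in \<open>auto simp: abs_mult intro!: mult_left_mono\<close>)
  show ?thesis
    unfolding disc_cost_def
    by (subst integral_suminf[OF int _ 1])
      (use 2 integral_traj_law_coord(2)[of "\<lambda>y. c (fst y) (snd y)"] in \<open>auto\<close>)
qed

end

section \<open>Discounted resolvents\<close>

locale discounted_chain =
  fixes p :: "'s::finite \<Rightarrow> 's \<Rightarrow> real" and \<gamma> :: real
  assumes nonneg: "0 \<le> p s s'"
    and row_sum: "(\<Sum>s'\<in>UNIV. p s s') = 1"
    and discount: "0 < \<gamma>" "\<gamma> < 1"
begin

definition T :: "('s \<Rightarrow> real) \<Rightarrow> 's \<Rightarrow> real" where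
  "T h s = (\<Sum>s'\<in>UNIV. p s s' * h s')"

definition G :: "('s \<Rightarrow> real) \<Rightarrow> 's \<Rightarrow> real" where
  "G b s = (\<Sum>t. \<gamma> ^ t * (T ^^ t) b s)"

lemma T_mono: "(\<And>s. h s \<le> h' s) \<Longrightarrow> T h s \<le> T h' s"
  unfolding T_def by (intro sum_mono mult_left_mono nonneg)

lemma T_power_mono: "(\<And>s. h s \<le> h' s) \<Longrightarrow> (T ^^ t) h s \<le> (T ^^ t) h' s"
  by (induction t arbitrary: s) (auto intro: T_mono)

lemma T_power_const: "(T ^^ t) (\<lambda>_. k) = (\<lambda>_. k)"
  by (induction t) (auto simp: T_def sum_distrib_right[symmetric] row_sum)

lemma T_sum: "T (\<lambda>s. \<Sum>i\<in>I. k i * h i s) s = (\<Sum>i\<in>I. k i * T (h i) s)"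
  unfolding T_def by (simp add: sum_distrib_left mult.left_commute) (rule sum.swap)

lemma T_power_sum:
  "(T ^^ t) (\<lambda>s. \<Sum>i\<in>I. k i * h i s) = (\<lambda>s. \<Sum>i\<in>I. k i * (T ^^ t) (h i) s)"
  by (induction t) (auto simp: T_sum)

text \<open>Constants are fixed by the monotone map \<open>T\<close>, so \<open>h\<close> and all
  its iterates lie between the same two constants. This makes the series of \<open>G\<close>
  summable.\<close>

lemma T_power_bounded: "\<bar>(T ^^ t) h s\<bar> \<le> (\<Sum>s\<in>UNIV. \<bar>h s\<bar>)"
proof -
  have b: "\<bar>h s\<bar> \<le> (\<Sum>s\<in>UNIV. \<bar>h s\<bar>)" for s
    by (rule member_le_sum) auto
  then have "- (\<Sum>s\<in>UNIV. \<bar>h s\<bar>) \<le> h s" "h s \<le> (\<Sum>s\<in>UNIV. \<bar>h s\<bar>)" for s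
    using b[of s] by linarith+
  then have "(T ^^ t) (\<lambda>_. - (\<Sum>s\<in>UNIV. \<bar>h s\<bar>)) s \<le> (T ^^ t) h s"
    "(T ^^ t) h s \<le> (T ^^ t) (\<lambda>_. \<Sum>s\<in>UNIV. \<bar>h s\<bar>) s"
    by (intro T_power_mono; simp)+
  then show ?thesis
    unfolding T_power_const by simp
qed

lemma summable_G: "summable (\<lambda>t. \<gamma> ^ t * (T ^^ t) h s)"
proof (rule summable_comparison_test'[where N=0])
  show "summable (\<lambda>t. \<gamma> ^ t * (\<Sum>s\<in>UNIV. \<bar>h s\<bar>))"
    using discount by (intro summable_mult2 summable_geometric) simp
  show "norm (\<gamma> ^ t * (T ^^ t) h s) \<le> \<gamma> ^ t * (\<Sum>s\<in>UNIV. \<bar>h s\<bar>)" for t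
    using discount T_power_bounded by (auto simp: abs_mult intro!: mult_left_mono)
qed

lemma G_mono: "(\<And>s. h s \<le> h' s) \<Longrightarrow> G h s \<le> G h' s"
  unfolding G_def using discount
  by (intro suminf_le summable_G mult_left_mono T_power_mono) auto

lemma G_const: "G (\<lambda>_. k) s = k / (1 - \<gamma>)"
  unfolding G_def T_power_const using discount
  by (simp add: suminf_mult2[symmetric] suminf_geometric summable_geometric)

lemma G_sum: "G (\<lambda>s. \<Sum>i\<in>I. k i * h i s) s = (\<Sum>i\<in>I. k i * G (h i) s)"
  unfolding G_def T_power_sum
  by (simp add: sum_distrib_left mult.left_commute suminf_sum[symmetric] summable_mult summable_G
      suminf_mult[symmetric])

lemma G_lincomb: "G (\<lambda>s. h s + k * h' s) s = G h s + k * G h' s"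
  \<comment> \<open>Two summands are obtained from \<open>G_sum\<close> by taking the booleans as
    index set.\<close>
  using G_sum[of "\<lambda>i. if i then 1 else k" "\<lambda>i. if i then h else h'" UNIV s]
  by (simp add: UNIV_bool add.commute)

lemma G_unfold: "G h s = h s + \<gamma> * G (T h) s"
proof -
  have "G h s = h s + (\<Sum>t. \<gamma> ^ Suc t * (T ^^ Suc t) h s)"
    unfolding G_def using suminf_split_head[OF summable_G[of h s]] by simp
  also have "(\<Sum>t. \<gamma> ^ Suc t * (T ^^ Suc t) h s) = \<gamma> * G (T h) s"
    unfolding G_def
    by (subst suminf_mult[symmetric, OF summable_G]) (simp add: funpow_swap1 mult.assoc)
  finally show ?thesis .
qed

lemma G_T: "G (T h) s = T (G h) s"
proof -
  have "T (G h) s = (\<Sum>t. \<Sum>s'\<in>UNIV. p s s' * (\<gamma> ^ t * (T ^^ t) h s'))"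
    unfolding T_def[of "G h"] G_def
    by (subst suminf_sum) (auto intro: summable_mult summable_G simp: suminf_mult summable_G)
  also have "\<dots> = (\<Sum>t. \<gamma> ^ t * T ((T ^^ t) h) s)"
    unfolding T_def[of "(T ^^ _) h"] by (simp add: sum_distrib_left mult.left_commute)
  finally show ?thesis
    unfolding G_def by (simp add: funpow_swap1)
qed

lemma G_fixpoint: "G h s = h s + \<gamma> * T (G h) s"
  using G_unfold G_T by simp

text \<open>\<open>G\<close> inverts \<open>I - \<gamma> T\<close>. With monotonicity this yields
  \<open>le_GI\<close> and \<open>G_leI\<close>, the comparison principles for sub- and
  supersolutions of Bellman equations.\<close>

lemma G_residual: "G (\<lambda>s. x s - \<gamma> * T x s) s = x s"
  using G_lincomb[of x "- \<gamma>" "T x" s] G_unfold[of x s] by simp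

lemma le_GI:
  assumes "\<And>s. x s - \<gamma> * T x s \<le> b s"
  shows "x s \<le> G b s"
  using G_mono[of "\<lambda>s. x s - \<gamma> * T x s" b s] assms by (simp add: G_residual)

lemma G_leI:
  assumes "\<And>s. b s \<le> x s - \<gamma> * T x s"
  shows "G b s \<le> x s"
  using G_mono[of b "\<lambda>s. x s - \<gamma> * T x s" s] assms by (simp add: G_residual)

text \<open>The terms of the series from \<open>t = 1\<close> on inherit the sign of
  \<open>b\<close>, so dropping them gives an upper bound.\<close>

lemma G_le_self:
  assumes "\<And>s. b s \<le> 0"
  shows "G b s \<le> b s"
proof -
  have "T b s \<le> 0" for s
    using T_mono[of b "\<lambda>_. 0" s] assms by (simp add: T_def)
  then have "G (T b) s \<le> 0"
    using G_mono[of "T b" "\<lambda>_. 0" s] by (simp add: G_const)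
  then show ?thesis
    using G_unfold[of b s] discount by (simp add: mult_nonneg_nonpos)
qed

text \<open>\<open>G (indicator {s'}) s\<close> is the \<open>(s, s')\<close> entry of the inverse
  matrix of \<open>I - \<gamma> T\<close>, that is, the visitation measure up to the factor
  \<open>1 - \<gamma>\<close>.\<close>

lemma G_eq_sum_indicator: "G b s = (\<Sum>s'\<in>UNIV. b s' * G (indicator {s'}) s)"
  using G_sum[of b "\<lambda>s'. indicator {s'}" UNIV s] by (simp add: indicator_def)

end

section \<open>The state chain of a policy and a kernel\<close>

lemma pmf_pmf_of_vec:
  assumes "p \<in> prob_simplex"
  shows "pmf (pmf_of_vec p) i = p $ i"
  unfolding pmf_of_vec_def
proof (rule pmf_embed_pmf)
  show "0 \<le> p $ i" for i
    using assms by (simp add: prob_simplex_def)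
  have "(\<Sum>i\<in>UNIV. ennreal (p $ i)) = ennreal (\<Sum>i\<in>UNIV. p $ i)"
    using assms by (intro sum_ennreal) (simp add: prob_simplex_def)
  then show "(\<integral>\<^sup>+i. ennreal (p $ i) \<partial>count_space UNIV) = 1"
    using assms by (simp add: nn_integral_count_space_finite prob_simplex_def)
qed

lemma expectation_pmf_of_vec:
  fixes h :: "'n::finite \<Rightarrow> real"
  assumes "p \<in> prob_simplex"
  shows "measure_pmf.expectation (pmf_of_vec p) h = (\<Sum>i\<in>UNIV. p $ i * h i)"
  by (subst integral_measure_pmf_real[where A=UNIV])
    (auto simp: pmf_pmf_of_vec assms mult.commute)

lemma expectation_bind_finite:
  fixes h :: "'b::finite \<Rightarrow> real" and M :: "'a::finite pmf"
  shows "measure_pmf.expectation (bind_pmf M f) h =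
    measure_pmf.expectation M (\<lambda>x. measure_pmf.expectation (f x) h)"
  by (subst pmf_expectation_bind[where A=UNIV], simp_all)
    (subst integral_measure_pmf_real[where A=UNIV], auto simp: mult.commute)

definition state_trans :: "real^'a^'s \<Rightarrow> real^'s^'a^'s \<Rightarrow> 's \<Rightarrow> 's \<Rightarrow> real" where
  "state_trans \<pi> P s s' = (\<Sum>a\<in>UNIV. \<pi> $ s $ a * P $ s $ a $ s')"

locale controlled_chain =
  fixes \<pi> :: "real^'a::finite^'s::finite" and P :: "real^'s^'a^'s" and \<gamma> :: real
  assumes policy: "\<pi> \<in> policies" and kernel: "P \<in> kernels" and discount': "0 < \<gamma>" "\<gamma> < 1"
begin

lemma policyD: "\<pi> $ s \<in> prob_simplex" "0 \<le> \<pi> $ s $ a" "(\<Sum>a\<in>UNIV. \<pi> $ s $ a) = 1"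
  using policy by (auto simp: policies_def prob_simplex_def)

lemma kernelD: "P $ s $ a \<in> prob_simplex" "0 \<le> P $ s $ a $ s'" "(\<Sum>s'\<in>UNIV. P $ s $ a $ s') = 1"
  using kernel by (auto simp: kernels_def prob_simplex_def)

sublocale discounted_chain "state_trans \<pi> P" \<gamma>
proof
  show "0 \<le> state_trans \<pi> P s s'" for s s'
    unfolding state_trans_def by (intro sum_nonneg mult_nonneg_nonneg policyD kernelD)
  show "(\<Sum>s'\<in>UNIV. state_trans \<pi> P s s') = 1" for s
    unfolding state_trans_def
    by (subst sum.swap) (simp add: sum_distrib_left[symmetric] kernelD policyD)
qed (rule discount')+

lemma T_alt: "T h s = (\<Sum>a\<in>UNIV. \<pi> $ s $ a * (\<Sum>s'\<in>UNIV. P $ s $ a $ s' * h s'))"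
  unfolding T_def state_trans_def
  by (simp add: sum_distrib_left sum_distrib_right mult.assoc) (rule sum.swap)

lemma expectation_start_state:
  "measure_pmf.expectation (start_state \<pi> s) f = (\<Sum>a\<in>UNIV. \<pi> $ s $ a * f (s, a))"
  by (simp add: start_state_def expectation_pmf_of_vec policyD)

lemma expectation_next_pair:
  "measure_pmf.expectation (next_pair \<pi> P y) f =
    (\<Sum>s'\<in>UNIV. P $ fst y $ snd y $ s' * (\<Sum>a\<in>UNIV. \<pi> $ s' $ a * f (s', a)))"
  by (simp add: next_pair_def expectation_bind_finite expectation_pmf_of_vec policyD kernelD)

text \<open>Averaging over the action turns a function of pairs into one of states; one
  \<open>next_pair\<close> step then becomes one application of \<open>T\<close>.\<close>

lemma expectation_marginal_start_state:
  "measure_pmf.expectation (marginal (start_state \<pi> s) \<pi> P t) f =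
    (T ^^ t) (\<lambda>s. \<Sum>a\<in>UNIV. \<pi> $ s $ a * f (s, a)) s"
proof (induction t arbitrary: f)
  case 0
  show ?case by (simp add: expectation_start_state)
next
  case (Suc t)
  show ?case
    by (simp add: expectation_bind_finite expectation_next_pair Suc.IH funpow_swap1)
      (simp add: T_alt[abs_def])
qed

text \<open>Only the first transition uses the prescribed action; from time 1 on the state chain of
  \<open>\<pi>\<close> runs, so time \<open>Suc t\<close> corresponds to
  \<open>T ^^ t\<close>.\<close>

lemma expectation_marginal_return:
  "measure_pmf.expectation (marginal (return_pmf (s, a)) \<pi> P (Suc t)) f =
    (\<Sum>s'\<in>UNIV. P $ s $ a $ s' * (T ^^ t) (\<lambda>s. \<Sum>a\<in>UNIV. \<pi> $ s $ a * f (s, a)) s')"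
proof (induction t arbitrary: f)
  case 0
  show ?case by (simp add: bind_return_pmf expectation_next_pair)
next
  case (Suc t)
  show ?case
    unfolding marginal.simps(2)[of _ _ _ "Suc t"] expectation_bind_finite Suc.IH
    by (simp only: expectation_next_pair fst_conv snd_conv T_alt[symmetric] funpow_Suc_right o_def)
qed

lemma V_val_eq_G: "V_val c \<gamma> P \<pi> = G (\<lambda>s. \<Sum>a\<in>UNIV. \<pi> $ s $ a * c s a)"
  by (rule ext) (simp add: V_val_def integral_disc_cost discount expectation_marginal_start_state G_def)

lemma Q_val_eq:
  "Q_val c \<gamma> P \<pi> s a = c s a + \<gamma> * (\<Sum>s'\<in>UNIV. P $ s $ a $ s' * V_val c \<gamma> P \<pi> s')"
proof -
  let ?m = "\<lambda>t. measure_pmf.expectation (marginal (return_pmf (s, a)) \<pi> P t) (\<lambda>y. c (fst y) (snd y))"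
  let ?b = "\<lambda>s. \<Sum>a\<in>UNIV. \<pi> $ s $ a * c s a"
  \<comment> \<open>The cost at time \<open>Suc t\<close> is one transition from
    \<open>(s, a)\<close> followed by the \<open>t\<close>-th term of the series of
    \<open>V_val\<close>.\<close>
  have m: "\<gamma> ^ Suc t * ?m (Suc t) = (\<Sum>s'\<in>UNIV. \<gamma> * P $ s $ a $ s' * (\<gamma> ^ t * (T ^^ t) ?b s'))" for t
    unfolding expectation_marginal_return by (simp add: sum_distrib_left mult_ac)
  have s: "summable (\<lambda>t. \<gamma> ^ Suc t * ?m (Suc t))"
    unfolding m by (intro summable_sum summable_mult summable_G)
  then have s': "summable (\<lambda>t. \<gamma> ^ t * ?m t)"
    by (subst summable_Suc_iff[symmetric])
  have "Q_val c \<gamma> P \<pi> s a = ?m 0 + (\<Sum>t. \<gamma> ^ Suc t * ?m (Suc t))"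
    unfolding Q_val_def integral_disc_cost[OF discount]
    using s' by (subst suminf_split_head) simp_all
  also have "(\<Sum>t. \<gamma> ^ Suc t * ?m (Suc t)) = \<gamma> * (\<Sum>s'\<in>UNIV. P $ s $ a $ s' * V_val c \<gamma> P \<pi> s')"
    unfolding m V_val_eq_G
    by (subst suminf_sum)
      (auto intro!: summable_mult summable_G simp: suminf_mult summable_G G_def sum_distrib_left mult.assoc)
  finally show ?thesis by simp
qed

lemma V_val_bellman:
  "V_val c \<gamma> P \<pi> s = (\<Sum>a\<in>UNIV. \<pi> $ s $ a * c s a) + \<gamma> * T (V_val c \<gamma> P \<pi>) s"
  unfolding V_val_eq_G by (rule G_fixpoint)

lemma visit_eq: "visit \<gamma> P \<pi> s s' = (1 - \<gamma>) * G (indicator {s'}) s"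
  unfolding visit_def prob_traj_law_coord expectation_marginal_start_state G_def
  by (simp add: sum_distrib_right[symmetric] policyD)

lemma sum_visit: "(\<Sum>s'\<in>UNIV. visit \<gamma> P \<pi> s s' * b s') = (1 - \<gamma>) * G b s"
  unfolding visit_eq G_eq_sum_indicator[of b] by (simp add: sum_distrib_left mult_ac)

lemma sum_visit_from:
  "(\<Sum>s'\<in>UNIV. visit_from \<gamma> P \<pi> \<rho> s' * b s') = (1 - \<gamma>) * (\<Sum>s\<in>UNIV. \<rho> $ s * G b s)"
proof -
  have "(\<Sum>s'\<in>UNIV. visit_from \<gamma> P \<pi> \<rho> s' * b s') =
      (\<Sum>s\<in>UNIV. \<rho> $ s * (\<Sum>s'\<in>UNIV. visit \<gamma> P \<pi> s s' * b s'))"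
    unfolding visit_from_def
    by (simp add: sum_distrib_left sum_distrib_right mult.assoc) (rule sum.swap)
  then show ?thesis
    unfolding sum_visit by (simp add: sum_distrib_left mult_ac)
qed

lemma visit_from_nonneg:
  assumes "\<rho> \<in> prob_simplex"
  shows "0 \<le> visit_from \<gamma> P \<pi> \<rho> s'"
proof -
  have "0 \<le> G (indicator {s'}) s" for s
    using G_mono[of "\<lambda>_. 0" "indicator {s'}" s] by (simp add: G_const)
  then show ?thesis
    using assms discount unfolding visit_from_def visit_eq
    by (intro sum_nonneg mult_nonneg_nonneg) (auto simp: prob_simplex_def)
qed

lemma sum_visit_from_1:
  assumes "\<rho> \<in> prob_simplex"
  shows "(\<Sum>s'\<in>UNIV. visit_from \<gamma> P \<pi> \<rho> s') = 1"
  using sum_visit_from[of \<rho> "\<lambda>_. 1"] assms discount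
  by (simp add: G_const sum_divide_distrib[symmetric] prob_simplex_def)

end

section \<open>Robust Bellman equations and performance difference\<close>

locale robust_mdp =
  fixes c :: "'s::finite \<Rightarrow> 'a::finite \<Rightarrow> real" and \<gamma> :: real
    and PN :: "real^'s^'a^'s" and U :: "(real^'s^'a^'s) set"
  assumes cost: "0 \<le> c s a" "c s a \<le> 1"
    and discount: "0 < \<gamma>" "\<gamma> < 1"
    and U_nonempty: "U \<noteq> {}" and U_compact: "compact U" and U_rect: "rectangular U"
    and U_kernel: "u \<in> U \<Longrightarrow> PN + u \<in> kernels"
begin

abbreviation "Vr \<equiv> V_robust c \<gamma> PN U"
abbreviation "Qr \<equiv> Q_robust c \<gamma> PN U"

lemma chain: "\<pi> \<in> policies \<Longrightarrow> u \<in> U \<Longrightarrow> controlled_chain \<pi> (PN + u) \<gamma>"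
  by unfold_locales (auto intro: U_kernel discount)

text \<open>Compare the expected cost with the constants 0 and 1. The upper bound makes
  \<open>V_robust\<close> a supremum of a bounded set.\<close>

lemma V_val_bounds:
  assumes "\<pi> \<in> policies" "u \<in> U"
  shows "0 \<le> V_val c \<gamma> (PN + u) \<pi> s" "V_val c \<gamma> (PN + u) \<pi> s \<le> 1 / (1 - \<gamma>)"
proof -
  interpret controlled_chain \<pi> "PN + u" \<gamma>
    using assms by (rule chain)
  have "0 \<le> (\<Sum>a\<in>UNIV. \<pi> $ s $ a * c s a)" for s
    by (intro sum_nonneg mult_nonneg_nonneg policyD cost)
  then show "0 \<le> V_val c \<gamma> (PN + u) \<pi> s"
    using G_mono[of "\<lambda>_. 0" "\<lambda>s. \<Sum>a\<in>UNIV. \<pi> $ s $ a * c s a" s]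
    by (simp add: V_val_eq_G G_const)
  have "(\<Sum>a\<in>UNIV. \<pi> $ s $ a * c s a) \<le> (\<Sum>a\<in>UNIV. \<pi> $ s $ a * 1)" for s
    by (intro sum_mono mult_left_mono policyD cost)
  then show "V_val c \<gamma> (PN + u) \<pi> s \<le> 1 / (1 - \<gamma>)"
    using G_mono[of "\<lambda>s. \<Sum>a\<in>UNIV. \<pi> $ s $ a * c s a" "\<lambda>_. 1" s]
    by (simp add: V_val_eq_G G_const policyD)
qed

lemma V_val_le_V_robust:
  assumes "\<pi> \<in> policies" "u \<in> U"
  shows "V_val c \<gamma> (PN + u) \<pi> s \<le> Vr \<pi> s"
  unfolding V_robust_def
  by (rule cSUP_upper[OF assms(2)]) (auto intro!: bdd_aboveI[where M="1 / (1 - \<gamma>)"] V_val_bounds assms)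

lemma V_robust_bounds:
  assumes "\<pi> \<in> policies"
  shows "0 \<le> Vr \<pi> s" "Vr \<pi> s \<le> 1 / (1 - \<gamma>)"
proof -
  obtain u where "u \<in> U"
    using U_nonempty by blast
  then show "0 \<le> Vr \<pi> s"
    using V_val_bounds(1)[OF assms, of u s] V_val_le_V_robust[OF assms, of u s] by linarith
  show "Vr \<pi> s \<le> 1 / (1 - \<gamma>)"
    unfolding V_robust_def by (intro cSUP_least U_nonempty V_val_bounds assms)
qed

text \<open>Compactness gives a maximizer for each pair \<open>(s, a)\<close>; rectangularity allows
  the row \<open>(s, a)\<close> to be taken from the maximizer for that pair, so one element of
  \<open>U\<close> is greedy at all pairs.\<close>

lemma ex_greedy_kernel:
  fixes h :: "'s \<Rightarrow> real"
  obtains u where "u \<in> U"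
    "\<And>u' s a. u' \<in> U \<Longrightarrow>
      (\<Sum>s'\<in>UNIV. (PN + u') $ s $ a $ s' * h s') \<le> (\<Sum>s'\<in>UNIV. (PN + u) $ s $ a $ s' * h s')"
proof -
  have "\<exists>v\<in>U. \<forall>u'\<in>U.
      (\<Sum>s'\<in>UNIV. (PN + u') $ s $ a $ s' * h s') \<le> (\<Sum>s'\<in>UNIV. (PN + v) $ s $ a $ s' * h s')" for s a
    by (rule continuous_attains_sup[OF U_compact U_nonempty]) (intro continuous_intros)
  then have ex: "\<exists>v. v \<in> U \<and> (\<forall>u'\<in>U.
      (\<Sum>s'\<in>UNIV. (PN + u') $ s $ a $ s' * h s') \<le> (\<Sum>s'\<in>UNIV. (PN + v) $ s $ a $ s' * h s'))" for s a
    by blast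
  define v where "v s a = (SOME v. v \<in> U \<and> (\<forall>u'\<in>U.
      (\<Sum>s'\<in>UNIV. (PN + u') $ s $ a $ s' * h s') \<le> (\<Sum>s'\<in>UNIV. (PN + v) $ s $ a $ s' * h s')))" for s a
  have v: "v s a \<in> U"
    "u' \<in> U \<Longrightarrow>
      (\<Sum>s'\<in>UNIV. (PN + u') $ s $ a $ s' * h s') \<le> (\<Sum>s'\<in>UNIV. (PN + v s a) $ s $ a $ s' * h s')" for s a u'
    using someI_ex[OF ex[of s a], folded v_def] by blast+
  define u where "u = (\<chi> s a. v s a $ s $ a)"
  have "u \<in> U"
    using U_rect v(1) unfolding rectangular_def u_def by auto
  moreover have e: "(PN + u) $ s $ a = (PN + v s a) $ s $ a" for s a
    by (simp add: u_def)
  have "(\<Sum>s'\<in>UNIV. (PN + u') $ s $ a $ s' * h s') \<le> (\<Sum>s'\<in>UNIV. (PN + u) $ s $ a $ s' * h s')"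
    if "u' \<in> U" for u' s a
    unfolding e using that by (rule v(2))
  ultimately show ?thesis
    by (rule that)
qed

text \<open>A kernel that is greedy for the robust value attains it at all states at once: by
  monotonicity the robust value is a subsolution of its Bellman equation.\<close>

lemma ex_worst_kernel:
  assumes \<pi>: "\<pi> \<in> policies"
  shows "\<exists>u\<in>U. (\<forall>s. Vr \<pi> s = V_val c \<gamma> (PN + u) \<pi> s) \<and>
    (\<forall>s a. Qr \<pi> $ s $ a = c s a + \<gamma> * (\<Sum>s'\<in>UNIV. (PN + u) $ s $ a $ s' * Vr \<pi> s')) \<and>
    (\<forall>s a. \<forall>u'\<in>U. c s a + \<gamma> * (\<Sum>s'\<in>UNIV. (PN + u') $ s $ a $ s' * Vr \<pi> s') \<le> Qr \<pi> $ s $ a)"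
proof -
  obtain u where u: "u \<in> U" "\<And>u' s a. u' \<in> U \<Longrightarrow>
      (\<Sum>s'\<in>UNIV. (PN + u') $ s $ a $ s' * Vr \<pi> s') \<le> (\<Sum>s'\<in>UNIV. (PN + u) $ s $ a $ s' * Vr \<pi> s')"
    using ex_greedy_kernel by blast
  interpret C: controlled_chain \<pi> "PN + u" \<gamma>
    using \<pi> u(1) by (rule chain)
  \<comment> \<open>In the Bellman equation of \<open>u'\<close>, the value is raised to
    \<open>Vr \<pi>\<close> and then the kernel to the greedy one. The right side no longer depends
    on \<open>u'\<close>, so the supremum can be taken on the left.\<close>
  have step: "V_val c \<gamma> (PN + u') \<pi> s \<le> (\<Sum>a\<in>UNIV. \<pi> $ s $ a * c s a) + \<gamma> * C.T (Vr \<pi>) s"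
    if u': "u' \<in> U" for u' s
  proof -
    interpret C': controlled_chain \<pi> "PN + u'" \<gamma>
      using \<pi> u' by (rule chain)
    have "C'.T (V_val c \<gamma> (PN + u') \<pi>) s \<le> C'.T (Vr \<pi>) s"
      by (intro C'.T_mono V_val_le_V_robust \<pi> u')
    also have "\<dots> \<le> C.T (Vr \<pi>) s"
      unfolding C'.T_alt C.T_alt by (intro sum_mono mult_left_mono u(2)[OF u'] C.policyD)
    finally show ?thesis
      using C'.V_val_bellman[of c s] discount by simp
  qed
  have "Vr \<pi> s \<le> (\<Sum>a\<in>UNIV. \<pi> $ s $ a * c s a) + \<gamma> * C.T (Vr \<pi>) s" for s
    unfolding V_robust_def[of c \<gamma> PN U \<pi> s] by (intro cSUP_least U_nonempty step)
  then have "Vr \<pi> s - \<gamma> * C.T (Vr \<pi>) s \<le> (\<Sum>a\<in>UNIV. \<pi> $ s $ a * c s a)" for s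
    by (simp add: algebra_simps)
  then have "Vr \<pi> s \<le> V_val c \<gamma> (PN + u) \<pi> s" for s
    unfolding C.V_val_eq_G by (rule C.le_GI)
  then have V: "Vr \<pi> s = V_val c \<gamma> (PN + u) \<pi> s" for s
    by (intro antisym V_val_le_V_robust \<pi> u(1))
  \<comment> \<open>The same two replacements, now after a first step from
    \<open>(s, a)\<close>.\<close>
  have le: "Q_val c \<gamma> (PN + u') \<pi> s a \<le> c s a + \<gamma> * (\<Sum>s'\<in>UNIV. (PN + u) $ s $ a $ s' * Vr \<pi> s')"
    if u': "u' \<in> U" for u' s a
  proof -
    interpret C': controlled_chain \<pi> "PN + u'" \<gamma>
      using \<pi> u' by (rule chain)
    have "(\<Sum>s'\<in>UNIV. (PN + u') $ s $ a $ s' * V_val c \<gamma> (PN + u') \<pi> s')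
        \<le> (\<Sum>s'\<in>UNIV. (PN + u') $ s $ a $ s' * Vr \<pi> s')"
      by (intro sum_mono mult_left_mono V_val_le_V_robust \<pi> u' C'.kernelD)
    also have "\<dots> \<le> (\<Sum>s'\<in>UNIV. (PN + u) $ s $ a $ s' * Vr \<pi> s')"
      by (rule u(2)[OF u'])
    finally show ?thesis
      using discount by (simp add: C'.Q_val_eq)
  qed
  have Q: "Qr \<pi> $ s $ a = c s a + \<gamma> * (\<Sum>s'\<in>UNIV. (PN + u) $ s $ a $ s' * Vr \<pi> s')" for s a
  proof (rule antisym)
    show "Qr \<pi> $ s $ a \<le> c s a + \<gamma> * (\<Sum>s'\<in>UNIV. (PN + u) $ s $ a $ s' * Vr \<pi> s')"
      unfolding Q_robust_def by (simp only: vec_lambda_beta) (intro cSUP_least U_nonempty le)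
    have "Q_val c \<gamma> (PN + u) \<pi> s a \<le> Qr \<pi> $ s $ a"
      unfolding Q_robust_def
      by (simp only: vec_lambda_beta) (intro cSUP_upper u(1) bdd_aboveI2[OF le])
    then show "c s a + \<gamma> * (\<Sum>s'\<in>UNIV. (PN + u) $ s $ a $ s' * Vr \<pi> s') \<le> Qr \<pi> $ s $ a"
      by (simp only: C.Q_val_eq V)
  qed
  have "c s a + \<gamma> * (\<Sum>s'\<in>UNIV. (PN + u') $ s $ a $ s' * Vr \<pi> s') \<le> Qr \<pi> $ s $ a"
    if "u' \<in> U" for u' s a
    using u(2)[OF that, of s a] discount by (simp only: Q) simp
  then show ?thesis
    using V Q u(1) by blast
qed

text \<open>A fixed choice, so that the worst kernel of each iterate, and its visitation measure,
  can be named.\<close>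

definition worst :: "real^'a^'s \<Rightarrow> real^'s^'a^'s" where
  "worst \<pi> = (SOME u. u \<in> U \<and> (\<forall>s. Vr \<pi> s = V_val c \<gamma> (PN + u) \<pi> s) \<and>
    (\<forall>s a. Qr \<pi> $ s $ a = c s a + \<gamma> * (\<Sum>s'\<in>UNIV. (PN + u) $ s $ a $ s' * Vr \<pi> s')) \<and>
    (\<forall>s a. \<forall>u'\<in>U. c s a + \<gamma> * (\<Sum>s'\<in>UNIV. (PN + u') $ s $ a $ s' * Vr \<pi> s') \<le> Qr \<pi> $ s $ a))"

context
  fixes \<pi> :: "real^'a^'s"
  assumes \<pi>: "\<pi> \<in> policies"
begin

lemma worst_kernel:
  shows worst_in_U: "worst \<pi> \<in> U"
    and V_robust_worst: "Vr \<pi> s = V_val c \<gamma> (PN + worst \<pi>) \<pi> s"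
    and Q_robust_worst:
      "Qr \<pi> $ s $ a = c s a + \<gamma> * (\<Sum>s'\<in>UNIV. (PN + worst \<pi>) $ s $ a $ s' * Vr \<pi> s')"
    and Q_robust_ge:
      "u \<in> U \<Longrightarrow> c s a + \<gamma> * (\<Sum>s'\<in>UNIV. (PN + u) $ s $ a $ s' * Vr \<pi> s') \<le> Qr \<pi> $ s $ a"
proof -
  note w = someI_ex[OF ex_worst_kernel[OF \<pi>, unfolded Bex_def], folded worst_def]
  show "worst \<pi> \<in> U" "Vr \<pi> s = V_val c \<gamma> (PN + worst \<pi>) \<pi> s"
    "Qr \<pi> $ s $ a = c s a + \<gamma> * (\<Sum>s'\<in>UNIV. (PN + worst \<pi>) $ s $ a $ s' * Vr \<pi> s')"
    using w by blast+
  show "c s a + \<gamma> * (\<Sum>s'\<in>UNIV. (PN + u) $ s $ a $ s' * Vr \<pi> s') \<le> Qr \<pi> $ s $ a" if "u \<in> U"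
    using w that by blast
qed

text \<open>State and action values are attained by the same kernel, so its Bellman equation relates
  them.\<close>

lemma V_robust_eq_inner: "Vr \<pi> s = Qr \<pi> $ s \<bullet> \<pi> $ s"
proof -
  interpret controlled_chain \<pi> "PN + worst \<pi>" \<gamma>
    by (rule chain[OF \<pi> worst_in_U])
  have "Vr \<pi> s = (\<Sum>a\<in>UNIV. \<pi> $ s $ a * c s a) + \<gamma> * T (Vr \<pi>) s"
    using V_val_bellman[of c s] V_robust_worst by presburger
  also have "\<dots> = (\<Sum>a\<in>UNIV. \<pi> $ s $ a * Qr \<pi> $ s $ a)"
    unfolding T_alt Q_robust_worst
    by (simp add: sum_distrib_left sum.distrib distrib_left mult.left_commute)
  finally show ?thesis
    by (simp add: inner_vec_def mult.commute)
qed

lemma Q_robust_bounds: "0 \<le> Qr \<pi> $ s $ a" "Qr \<pi> $ s $ a \<le> 1 / (1 - \<gamma>)"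
proof -
  interpret controlled_chain \<pi> "PN + worst \<pi>" \<gamma>
    by (rule chain[OF \<pi> worst_in_U])
  have "0 \<le> (\<Sum>s'\<in>UNIV. (PN + worst \<pi>) $ s $ a $ s' * Vr \<pi> s')"
    by (intro sum_nonneg mult_nonneg_nonneg kernelD V_robust_bounds \<pi>)
  then show "0 \<le> Qr \<pi> $ s $ a"
    unfolding Q_robust_worst using cost discount by simp
  have "(\<Sum>s'\<in>UNIV. (PN + worst \<pi>) $ s $ a $ s' * Vr \<pi> s')
      \<le> (\<Sum>s'\<in>UNIV. (PN + worst \<pi>) $ s $ a $ s' * (1 / (1 - \<gamma>)))"
    by (intro sum_mono mult_left_mono kernelD V_robust_bounds \<pi>)
  also have "\<dots> = 1 / (1 - \<gamma>)"
    using kernelD(3)[of s a] by (simp only: sum_distrib_right[symmetric])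
  finally have "Qr \<pi> $ s $ a \<le> 1 + \<gamma> * (1 / (1 - \<gamma>))"
    unfolding Q_robust_worst using cost[of s a] discount by (intro add_mono mult_left_mono) auto
  also have "\<dots> = 1 / (1 - \<gamma>)"
    using discount by (simp add: field_simps)
  finally show "Qr \<pi> $ s $ a \<le> 1 / (1 - \<gamma>)" .
qed

text \<open>\<open>Qr \<pi>\<close> is the largest one-step lookahead on \<open>Vr \<pi>\<close>
  over all kernels in \<open>U\<close>, and \<open>worst \<pi>\<close> attains it; averaging over
  \<open>\<pi>'\<close> and subtracting \<open>Vr \<pi>\<close> leaves the advantage of
  \<open>\<pi>'\<close>.\<close>

lemma bellman_residual:
  assumes "\<pi>' \<in> policies" "u \<in> U"
  shows "(\<Sum>a\<in>UNIV. \<pi>' $ s $ a * c s a) + \<gamma> * discounted_chain.T (state_trans \<pi>' (PN + u)) (Vr \<pi>) s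
      - Vr \<pi> s \<le> Qr \<pi> $ s \<bullet> (\<pi>' $ s - \<pi> $ s)"
    (is "?l \<le> ?r")
    and "u = worst \<pi> \<Longrightarrow> (\<Sum>a\<in>UNIV. \<pi>' $ s $ a * c s a) + \<gamma> * discounted_chain.T (state_trans \<pi>' (PN + u)) (Vr \<pi>) s
      - Vr \<pi> s = Qr \<pi> $ s \<bullet> (\<pi>' $ s - \<pi> $ s)"
proof -
  interpret controlled_chain \<pi>' "PN + u" \<gamma>
    by (rule chain[OF assms])
  have eq: "(\<Sum>a\<in>UNIV. \<pi>' $ s $ a * c s a) + \<gamma> * T (Vr \<pi>) s =
      (\<Sum>a\<in>UNIV. \<pi>' $ s $ a * (c s a + \<gamma> * (\<Sum>s'\<in>UNIV. (PN + u) $ s $ a $ s' * Vr \<pi> s')))"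
    unfolding T_alt by (simp add: sum_distrib_left sum.distrib distrib_left mult.left_commute)
  have r: "?r = (\<Sum>a\<in>UNIV. \<pi>' $ s $ a * Qr \<pi> $ s $ a) - Vr \<pi> s"
    unfolding inner_diff_right V_robust_eq_inner by (simp add: inner_vec_def mult.commute)
  show "?l \<le> ?r"
    unfolding r eq
    by (intro diff_right_mono sum_mono mult_left_mono Q_robust_ge policyD assms)
  show "u = worst \<pi> \<Longrightarrow> ?l = ?r"
    unfolding r eq by (simp only: Q_robust_worst)
qed

end

text \<open>Under its own worst kernel \<open>Vr \<pi>'\<close> solves a Bellman equation exactly,
  so the difference is a subsolution with the advantage as source.\<close>

lemma V_robust_diff_le:
  assumes \<pi>: "\<pi> \<in> policies" and \<pi>': "\<pi>' \<in> policies"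
  shows "Vr \<pi>' s - Vr \<pi> s \<le>
    discounted_chain.G (state_trans \<pi>' (PN + worst \<pi>')) \<gamma> (\<lambda>s. Qr \<pi> $ s \<bullet> (\<pi>' $ s - \<pi> $ s)) s"
proof -
  interpret controlled_chain \<pi>' "PN + worst \<pi>'" \<gamma>
    by (rule chain[OF \<pi>' worst_in_U[OF \<pi>']])
  have "Vr \<pi>' s = (\<Sum>a\<in>UNIV. \<pi>' $ s $ a * c s a) + \<gamma> * T (Vr \<pi>') s" for s
    using V_val_bellman[of c s] V_robust_worst[OF \<pi>'] by presburger
  moreover have "T (\<lambda>s. Vr \<pi>' s - Vr \<pi> s) s = T (Vr \<pi>') s - T (Vr \<pi>) s" for s
    by (simp add: T_def right_diff_distrib sum_subtractf)
  ultimately have "(Vr \<pi>' s - Vr \<pi> s) - \<gamma> * T (\<lambda>s. Vr \<pi>' s - Vr \<pi> s) s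
      \<le> Qr \<pi> $ s \<bullet> (\<pi>' $ s - \<pi> $ s)" for s
    using bellman_residual(1)[OF \<pi> \<pi>' worst_in_U[OF \<pi>'], of s] by (simp add: right_diff_distrib)
  then show ?thesis
    by (rule le_GI)
qed

text \<open>The worst kernel of \<open>\<pi>\<close> makes the residual of \<open>Vr \<pi>\<close>
  exact; the value of \<open>\<pi>'\<close> under it is only a lower bound for
  \<open>Vr \<pi>'\<close>, which is the direction wanted.\<close>

lemma V_robust_diff_ge:
  assumes \<pi>: "\<pi> \<in> policies" and \<pi>': "\<pi>' \<in> policies"
  shows "discounted_chain.G (state_trans \<pi>' (PN + worst \<pi>)) \<gamma> (\<lambda>s. Qr \<pi> $ s \<bullet> (\<pi>' $ s - \<pi> $ s)) s
    \<le> Vr \<pi>' s - Vr \<pi> s"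
proof -
  interpret controlled_chain \<pi>' "PN + worst \<pi>" \<gamma>
    by (rule chain[OF \<pi>' worst_in_U[OF \<pi>]])
  let ?V = "V_val c \<gamma> (PN + worst \<pi>) \<pi>'"
  have "T (\<lambda>s. ?V s - Vr \<pi> s) s = T ?V s - T (Vr \<pi>) s" for s
    by (simp add: T_def right_diff_distrib sum_subtractf)
  then have "Qr \<pi> $ s \<bullet> (\<pi>' $ s - \<pi> $ s) \<le> (?V s - Vr \<pi> s) - \<gamma> * T (\<lambda>s. ?V s - Vr \<pi> s) s" for s
    using bellman_residual(2)[OF \<pi> \<pi>' worst_in_U[OF \<pi>] refl, of s] V_val_bellman[of c s]
    by (simp add: right_diff_distrib)
  then have "G (\<lambda>s. Qr \<pi> $ s \<bullet> (\<pi>' $ s - \<pi> $ s)) s \<le> ?V s - Vr \<pi> s"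
    by (rule G_leI)
  also have "\<dots> \<le> Vr \<pi>' s - Vr \<pi> s"
    by (simp add: V_val_le_V_robust \<pi>' worst_in_U[OF \<pi>])
  finally show ?thesis .
qed

end

section \<open>Mirror descent\<close>

text \<open>If \<open>y = 0\<close>, a finite ratio forces \<open>x = 0\<close>, since
  \<open>x / 0\<close> is infinite for positive \<open>x\<close>.\<close>

lemma le_of_ennreal_ratio_le:
  assumes "ennreal x / ennreal y \<le> ennreal k" "0 \<le> x" "0 \<le> y" "0 \<le> k"
  shows "x \<le> k * y"
proof (cases "y = 0")
  case True
  with assms have "x = 0"
    by (cases "x = 0") (auto simp: ennreal_divide_zero top_unique)
  with True show ?thesis by simp
next
  case False
  with assms have "ennreal (x / y) \<le> ennreal k"
    by (simp add: divide_ennreal)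
  with False assms show ?thesis
    by (simp add: divide_le_eq)
qed

lemma le_of_ratio_sup_le:
  assumes "ratio_sup \<mu> \<nu> \<le> K" "K < \<infinity>" "0 \<le> \<mu> s" "0 \<le> \<nu> s"
  shows "\<mu> s \<le> enn2real K * \<nu> s"
proof (rule le_of_ennreal_ratio_le)
  have "ennreal (\<mu> s) / ennreal (\<nu> s) \<le> ratio_sup \<mu> \<nu>"
    unfolding ratio_sup_def by (rule SUP_upper) simp
  with assms(1,2) show "ennreal (\<mu> s) / ennreal (\<nu> s) \<le> ennreal (enn2real K)"
    by simp
qed (use assms in auto)

lemma bregman_nonneg: "is_subgradient w q g \<Longrightarrow> 0 \<le> bregman w g p q"
  by (simp add: is_subgradient_def bregman_def algebra_simps)

lemma abs_nth_le_infnorm: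
  fixes x :: "real^'a::finite^'s::finite"
  shows "\<bar>x $ s $ a\<bar> \<le> infnorm x"
  using Basis_le_infnorm[of "axis s (axis a 1)" x] by (simp add: axis_in_Basis_iff inner_axis)

text \<open>Hoelder's inequality: the l1 distance of two distributions is at most 2.\<close>

lemma inner_simplex_diff_le:
  fixes x :: "real^'n::finite"
  assumes "\<And>i. \<bar>x $ i\<bar> \<le> e" "p \<in> prob_simplex" "p' \<in> prob_simplex"
  shows "x \<bullet> (p - p') \<le> 2 * e"
proof -
  have "x \<bullet> (p - p') \<le> (\<Sum>i\<in>UNIV. e * (p $ i + p' $ i))"
    unfolding inner_vec_def
  proof (rule sum_mono)
    fix i
    have p: "0 \<le> p $ i" "0 \<le> p' $ i"
      using assms by (auto simp: prob_simplex_def)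
    have "x $ i \<bullet> (p - p') $ i \<le> \<bar>x $ i\<bar> * \<bar>(p - p') $ i\<bar>"
      by (simp add: abs_mult[symmetric])
    also have "\<dots> \<le> e * (p $ i + p' $ i)"
      using p assms(1)[of i] by (intro mult_mono) auto
    finally show "x $ i \<bullet> (p - p') $ i \<le> e * (p $ i + p' $ i)" .
  qed
  also have "\<dots> = 2 * e"
    using assms by (simp add: sum_distrib_left[symmetric] sum.distrib prob_simplex_def)
  finally show ?thesis .
qed

context
  fixes w :: "real^'a::finite \<Rightarrow> real" and \<eta> :: "nat \<Rightarrow> real"
    and \<pi>0 g0 :: "real^'a^'s::finite" and Qe \<pi> g :: "nat \<Rightarrow> real^'a^'s"
  assumes path: "srpmd_path w \<eta> \<pi>0 g0 Qe \<pi> g" and \<eta>: "\<And>k. 0 < \<eta> k"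
begin

lemma srpmd_in_policies: "\<pi>0 \<in> policies \<Longrightarrow> \<pi> k \<in> policies"
  using path by (cases k) (auto simp: srpmd_path_def policies_def is_arg_min_def)

text \<open>The right side equals the inner product of \<open>g (Suc k) $ s - g k $ s\<close> with
  \<open>p - \<pi> (Suc k) $ s\<close>, so this is the first-order optimality condition
  rearranged.\<close>

lemma srpmd_three_point:
  assumes "p \<in> prob_simplex"
  shows "\<eta> k * (Qe k $ s \<bullet> (\<pi> (Suc k) $ s - p)) \<le>
    bregman w (g k $ s) p (\<pi> k $ s) - bregman w (g (Suc k) $ s) p (\<pi> (Suc k) $ s)
      - bregman w (g k $ s) (\<pi> (Suc k) $ s) (\<pi> k $ s)"
proof -
  have "0 \<le> (\<eta> k *\<^sub>R (Qe k $ s) + g (Suc k) $ s - g k $ s) \<bullet> (p - \<pi> (Suc k) $ s)"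
    using path assms by (simp add: srpmd_path_def)
  then show ?thesis
    by (simp add: bregman_def algebra_simps)
qed

lemma srpmd_bregman_nonneg: "0 \<le> bregman w (g k $ s) p (\<pi> k $ s)"
  using path by (simp add: srpmd_path_def bregman_nonneg)

text \<open>The three-point inequality at \<open>p = \<pi> k $ s\<close>, where the first divergence
  vanishes and the other two enter with a negative sign.\<close>

lemma srpmd_descent:
  assumes "\<pi>0 \<in> policies"
  shows "Qe k $ s \<bullet> (\<pi> (Suc k) $ s - \<pi> k $ s) \<le> 0"
proof -
  have "\<pi> k $ s \<in> prob_simplex"
    using srpmd_in_policies[OF assms] by (simp add: policies_def)
  from srpmd_three_point[OF this, of k s]
  have "\<eta> k * (Qe k $ s \<bullet> (\<pi> (Suc k) $ s - \<pi> k $ s)) \<le> 0"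
    using srpmd_bregman_nonneg[of "Suc k" s "\<pi> k $ s"] srpmd_bregman_nonneg[of k s "\<pi> (Suc k) $ s"]
    by (simp add: bregman_def[of _ _ "\<pi> k $ s" "\<pi> k $ s"])
  with \<eta>[of k] show ?thesis
    by (simp add: mult_le_0_iff)
qed

end

text \<open>Unrolling the contraction; the weights \<open>\<psi>\<close> of the potential at time \<open>k + 1\<close> are those of
  the kernel chosen at time \<open>k\<close>, and changing the kernel costs the factor \<open>M'\<close>.\<close>

lemma contraction_unroll:
  fixes a \<phi> \<psi> \<eta> \<epsilon> :: "nat \<Rightarrow> real"
  assumes q: "0 \<le> q" and M: "0 < M" and \<eta>: "\<And>k. 0 < \<eta> k" and \<psi>: "\<And>k. 0 \<le> \<psi> k"
    and step: "\<And>k. a (Suc k) + \<psi> k / (M * \<eta> k) \<le> q * a k + \<phi> k / (M * \<eta> k) + \<epsilon> k"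
    and change: "\<And>k. \<phi> (Suc k) \<le> M' * \<psi> k"
    and stepsize: "\<And>k. M' * \<eta> k \<le> q * \<eta> (Suc k)"
  shows "a (Suc k) + \<psi> k / (M * \<eta> k) \<le>
    q ^ Suc k * a 0 + q ^ k * (\<phi> 0 / (M * \<eta> 0)) + (\<Sum>t<Suc k. q ^ (k - t) * \<epsilon> t)"
proof (induction k)
  case 0
  then show ?case using step[of 0] by simp
next
  case (Suc k)
  \<comment> \<open>Changing the kernel costs \<open>M'\<close>; the stepsize growth pays for it and
    leaves the factor \<open>q\<close>, so the left side of the induction hypothesis
    reappears.\<close>
  have "\<phi> (Suc k) / (M * \<eta> (Suc k)) \<le> M' * \<psi> k / (M * \<eta> (Suc k))"
    using change[of k] M \<eta>[of "Suc k"] by (intro divide_right_mono) auto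
  also have "\<dots> \<le> q * (\<psi> k / (M * \<eta> k))"
  proof -
    have "(M' * \<eta> k) * \<psi> k \<le> (q * \<eta> (Suc k)) * \<psi> k"
      by (intro mult_right_mono stepsize \<psi>)
    then show ?thesis
      using M \<eta>[of k] \<eta>[of "Suc k"] by (simp add: field_simps)
  qed
  finally have "a (Suc (Suc k)) + \<psi> (Suc k) / (M * \<eta> (Suc k))
      \<le> q * (a (Suc k) + \<psi> k / (M * \<eta> k)) + \<epsilon> (Suc k)"
    using step[of "Suc k"] by (simp add: distrib_left)
  also have "q * (a (Suc k) + \<psi> k / (M * \<eta> k)) \<le>
      q * (q ^ Suc k * a 0 + q ^ k * (\<phi> 0 / (M * \<eta> 0)) + (\<Sum>t<Suc k. q ^ (k - t) * \<epsilon> t))"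
    by (intro mult_left_mono Suc.IH q)
  also have "\<dots> = q ^ Suc (Suc k) * a 0 + q ^ Suc k * (\<phi> 0 / (M * \<eta> 0))
      + (\<Sum>t<Suc k. q ^ (Suc k - t) * \<epsilon> t)"
    by (simp add: distrib_left sum_distrib_left Suc_diff_le mult.assoc)
  finally show ?case
    by simp
qed

section \<open>One mirror step in the robust objective\<close>

context robust_mdp
begin

abbreviation "f \<equiv> f_obj c \<gamma> PN U"

lemma visit_le_mismatch:
  assumes "\<pi> \<in> policies" "\<rho> \<in> prob_simplex" "u \<in> U" "mismatch \<gamma> PN U \<pi> \<rho> < \<infinity>"
  shows "visit_from \<gamma> (PN + u) \<pi> \<rho> s \<le> enn2real (mismatch \<gamma> PN U \<pi> \<rho>) * \<rho> $ s"
proof (rule le_of_ratio_sup_le[where \<mu>="visit_from \<gamma> (PN + u) \<pi> \<rho>" and \<nu>="($) \<rho>"])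
  interpret controlled_chain \<pi> "PN + u" \<gamma>
    by (rule chain) fact+
  show "ratio_sup (visit_from \<gamma> (PN + u) \<pi> \<rho>) (($) \<rho>) \<le> mismatch \<gamma> PN U \<pi> \<rho>"
    unfolding mismatch_def by (rule SUP_upper) fact
  show "0 \<le> visit_from \<gamma> (PN + u) \<pi> \<rho> s"
    by (rule visit_from_nonneg) fact
qed (use assms in \<open>auto simp: prob_simplex_def\<close>)

lemma visit_le_mismatch':
  assumes "\<pi> \<in> policies" "\<rho> \<in> prob_simplex" "u \<in> U" "u' \<in> U" "mismatch' \<gamma> PN U \<pi> \<rho> < \<infinity>"
  shows "visit_from \<gamma> (PN + u) \<pi> \<rho> s
    \<le> enn2real (mismatch' \<gamma> PN U \<pi> \<rho>) * visit_from \<gamma> (PN + u') \<pi> \<rho> s"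
proof (rule le_of_ratio_sup_le[where \<mu>="visit_from \<gamma> (PN + u) \<pi> \<rho>"
      and \<nu>="visit_from \<gamma> (PN + u') \<pi> \<rho>"])
  show "ratio_sup (visit_from \<gamma> (PN + u) \<pi> \<rho>) (visit_from \<gamma> (PN + u') \<pi> \<rho>) \<le> mismatch' \<gamma> PN U \<pi> \<rho>"
    unfolding mismatch'_def by (rule SUP_upper2[OF assms(3)], rule SUP_upper) fact
  show "0 \<le> visit_from \<gamma> (PN + u) \<pi> \<rho> s" "0 \<le> visit_from \<gamma> (PN + u') \<pi> \<rho> s"
    using assms by (auto intro!: controlled_chain.visit_from_nonneg chain)
qed (use assms in auto)

text \<open>Sum the entrywise bound over all states; both measures have mass 1. This keeps the
  contraction factor \<open>1 - (1 - \<gamma>) / M\<close> positive.\<close>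

lemma mismatch_ge_1:
  assumes "\<pi> \<in> policies" "\<rho> \<in> prob_simplex" "mismatch \<gamma> PN U \<pi> \<rho> < \<infinity>"
  shows "1 \<le> enn2real (mismatch \<gamma> PN U \<pi> \<rho>)"
proof -
  obtain u where u: "u \<in> U"
    using U_nonempty by blast
  have "1 = (\<Sum>s\<in>UNIV. visit_from \<gamma> (PN + u) \<pi> \<rho> s)"
    using controlled_chain.sum_visit_from_1[OF chain[OF assms(1) u] assms(2)] by simp
  also have "\<dots> \<le> (\<Sum>s\<in>UNIV. enn2real (mismatch \<gamma> PN U \<pi> \<rho>) * \<rho> $ s)"
    by (intro sum_mono visit_le_mismatch u assms)
  also have "\<dots> = enn2real (mismatch \<gamma> PN U \<pi> \<rho>)"
    using assms(2) by (simp add: sum_distrib_left[symmetric] prob_simplex_def)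
  finally show ?thesis .
qed

text \<open>All one-step advantages are at most \<open>2 * e\<close>. Shifting them by \<open>2 * e\<close> makes them nonpositive,
  so that the resolvent can be bounded by its first term.\<close>

lemma V_robust_step_le:
  assumes "\<pi> \<in> policies" "\<pi>' \<in> policies"
    and adv: "\<And>s. Qr \<pi> $ s \<bullet> (\<pi>' $ s - \<pi> $ s) \<le> 2 * e"
  shows "Vr \<pi>' s - Vr \<pi> s \<le> Qr \<pi> $ s \<bullet> (\<pi>' $ s - \<pi> $ s) - 2 * e + 2 * e / (1 - \<gamma>)"
proof -
  interpret controlled_chain \<pi>' "PN + worst \<pi>'" \<gamma>
    by (intro chain worst_in_U assms)
  let ?b = "\<lambda>s. Qr \<pi> $ s \<bullet> (\<pi>' $ s - \<pi> $ s)"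
  have "Vr \<pi>' s - Vr \<pi> s \<le> G ?b s"
    by (intro V_robust_diff_le assms)
  also have "\<dots> = G (\<lambda>s. ?b s - 2 * e) s + 2 * e / (1 - \<gamma>)"
    using G_lincomb[of "\<lambda>s. ?b s - 2 * e" 1 "\<lambda>_. 2 * e" s] by (simp add: G_const)
  also have "G (\<lambda>s. ?b s - 2 * e) s \<le> ?b s - 2 * e"
    using adv by (intro G_le_self) simp
  finally show ?thesis by simp
qed

text \<open>The gap to \<open>p\<close> is bounded through the advantages of \<open>p\<close> under
  the worst kernel of \<open>\<pi>\<close>; the three-point inequality trades these for the
  advantages of \<open>\<pi>'\<close>, which \<open>V_robust_step_le\<close> turns into the decrease
  from \<open>\<pi>\<close> to \<open>\<pi>'\<close>.\<close>

lemma mirror_step: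
  assumes \<pi>: "\<pi> \<in> policies" and \<pi>': "\<pi>' \<in> policies" and p: "p \<in> policies"
    and \<rho>: "\<rho> \<in> prob_simplex" and \<eta>: "0 < \<eta>" and K: "0 \<le> K"
    and visit: "\<And>s. visit_from \<gamma> (PN + worst \<pi>) p \<rho> s \<le> K * \<rho> $ s"
    and est: "\<And>s a. \<bar>(Qe - Qr \<pi>) $ s $ a\<bar> \<le> e"
    and three_point: "\<And>s. \<eta> * (Qe $ s \<bullet> (\<pi>' $ s - p $ s)) \<le> \<Delta> s"
    and descent: "\<And>s. Qe $ s \<bullet> (\<pi>' $ s - \<pi> $ s) \<le> 0"
  shows "(1 - \<gamma>) * (f \<rho> \<pi> - f \<rho> p) \<le> K * (f \<rho> \<pi> - f \<rho> \<pi>') + 2 * K * e / (1 - \<gamma>)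
    + (\<Sum>s\<in>UNIV. visit_from \<gamma> (PN + worst \<pi>) p \<rho> s * \<Delta> s) / \<eta>"
proof -
  interpret controlled_chain p "PN + worst \<pi>" \<gamma>
    by (intro chain worst_in_U assms)
  define d where "d = visit_from \<gamma> (PN + worst \<pi>) p \<rho>"
  have d: "0 \<le> d s" "d s \<le> K * \<rho> $ s" for s
    unfolding d_def using visit_from_nonneg[OF \<rho>] visit by auto
  have est': "(Qr \<pi> - Qe) $ s \<bullet> (r $ s - r' $ s) \<le> 2 * e"
    if "r \<in> policies" "r' \<in> policies" for r r' s
    using that est by (intro inner_simplex_diff_le) (auto simp: policies_def abs_minus_commute)
  define adv where "adv s = Qr \<pi> $ s \<bullet> (\<pi>' $ s - \<pi> $ s)" for s
  have adv: "adv s \<le> 2 * e" for s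
    using est'[OF \<pi>' \<pi>, of s] descent[of s] by (simp add: adv_def inner_diff_left)
  have V: "Vr \<pi>' s - Vr \<pi> s \<le> adv s - 2 * e + 2 * e / (1 - \<gamma>)" for s
    unfolding adv_def by (intro V_robust_step_le \<pi> \<pi>') (use adv in \<open>simp add: adv_def\<close>)
  \<comment> \<open>Split \<open>\<pi> - p\<close> at \<open>\<pi>'\<close>, and replace
    \<open>Qr\<close> by \<open>Qe\<close> in the part from \<open>p\<close> to
    \<open>\<pi>'\<close> at cost \<open>2 * e\<close>.\<close>
  have point: "- (Qr \<pi> $ s \<bullet> (p $ s - \<pi> $ s)) \<le> (2 * e - adv s) + \<Delta> s / \<eta>" for s
  proof -
    have "Qe $ s \<bullet> (\<pi>' $ s - p $ s) \<le> \<Delta> s / \<eta>"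
      using three_point[of s] \<eta> by (simp add: pos_le_divide_eq mult.commute)
    then show ?thesis
      using est'[OF \<pi>' p, of s] by (simp add: adv_def inner_diff_left inner_diff_right)
  qed
  have "f \<rho> p - f \<rho> \<pi> = (\<Sum>s\<in>UNIV. \<rho> $ s * (Vr p s - Vr \<pi> s))"
    by (simp add: f_obj_def right_diff_distrib sum_subtractf)
  also have "\<dots> \<ge> (\<Sum>s\<in>UNIV. \<rho> $ s * G (\<lambda>s. Qr \<pi> $ s \<bullet> (p $ s - \<pi> $ s)) s)"
    using \<rho> by (intro sum_mono mult_left_mono V_robust_diff_ge assms) (simp add: prob_simplex_def)
  finally have "(1 - \<gamma>) * (\<Sum>s\<in>UNIV. \<rho> $ s * G (\<lambda>s. Qr \<pi> $ s \<bullet> (p $ s - \<pi> $ s)) s)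
      \<le> (1 - \<gamma>) * (f \<rho> p - f \<rho> \<pi>)"
    using discount' by (intro mult_left_mono) auto
  then have "(1 - \<gamma>) * (f \<rho> \<pi> - f \<rho> p) \<le> - (\<Sum>s\<in>UNIV. d s * (Qr \<pi> $ s \<bullet> (p $ s - \<pi> $ s)))"
    unfolding sum_visit_from[symmetric] d_def by (simp add: right_diff_distrib)
  also have "\<dots> = (\<Sum>s\<in>UNIV. d s * - (Qr \<pi> $ s \<bullet> (p $ s - \<pi> $ s)))"
    by (simp add: sum_negf)
  also have "\<dots> \<le> (\<Sum>s\<in>UNIV. d s * ((2 * e - adv s) + \<Delta> s / \<eta>))"
    by (intro sum_mono mult_left_mono point d)
  also have "\<dots> = (\<Sum>s\<in>UNIV. d s * (2 * e - adv s)) + (\<Sum>s\<in>UNIV. d s * \<Delta> s) / \<eta>"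
    by (simp add: distrib_left sum.distrib sum_divide_distrib)
  \<comment> \<open>Since \<open>2 * e - adv s\<close> is nonnegative, the weight \<open>d\<close>
    may be raised to \<open>K\<close> times \<open>\<rho>\<close>, the weight of the
    objective.\<close>
  also have "(\<Sum>s\<in>UNIV. d s * (2 * e - adv s)) \<le>
      (\<Sum>s\<in>UNIV. K * \<rho> $ s * (Vr \<pi> s - Vr \<pi>' s + 2 * e / (1 - \<gamma>)))"
  proof (rule sum_mono)
    fix s
    have "d s * (2 * e - adv s) \<le> K * \<rho> $ s * (2 * e - adv s)"
      using adv[of s] by (intro mult_right_mono d) auto
    also have "\<dots> \<le> K * \<rho> $ s * (Vr \<pi> s - Vr \<pi>' s + 2 * e / (1 - \<gamma>))"
      using V[of s] K \<rho> by (intro mult_left_mono) (auto simp: prob_simplex_def)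
    finally show "d s * (2 * e - adv s) \<le> K * \<rho> $ s * (Vr \<pi> s - Vr \<pi>' s + 2 * e / (1 - \<gamma>))" .
  qed
  also have "\<dots> = K * (f \<rho> \<pi> - f \<rho> \<pi>') + K * (2 * e / (1 - \<gamma>)) * (\<Sum>s\<in>UNIV. \<rho> $ s)"
    unfolding f_obj_def
    by (simp only: sum_distrib_left sum_subtractf[symmetric] sum.distrib[symmetric])
      (intro sum.cong refl, simp add: algebra_simps)
  finally show ?thesis
    using \<rho> by (simp add: d_def prob_simplex_def mult_ac)
qed

section \<open>Lipschitz continuity of the robust values in the policy\<close>

lemma V_robust_lipschitz:
  assumes "\<pi> \<in> policies" "\<pi>' \<in> policies"
  shows "Vr \<pi>' s - Vr \<pi> s \<le> CARD('a) / (1 - \<gamma>)\<^sup>2 * norm (\<pi>' - \<pi>)"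
proof -
  interpret controlled_chain \<pi>' "PN + worst \<pi>'" \<gamma>
    by (intro chain worst_in_U assms)
  \<comment> \<open>Cauchy-Schwarz bound for the advantage, from entries of \<open>Qr\<close> of
    size at most \<open>1 / (1 - \<gamma>)\<close>; the resolvent contributes the second factor
    \<open>1 / (1 - \<gamma>)\<close>.\<close>
  let ?C = "CARD('a) / (1 - \<gamma>) * norm (\<pi>' - \<pi>)"
  have "Qr \<pi> $ s \<bullet> (\<pi>' $ s - \<pi> $ s) \<le> ?C" for s
  proof -
    have "norm (Qr \<pi> $ s) \<le> (\<Sum>a\<in>UNIV. \<bar>Qr \<pi> $ s $ a\<bar>)"
      by (rule norm_le_l1_cart)
    also have "\<dots> \<le> (\<Sum>a\<in>(UNIV::'a set). 1 / (1 - \<gamma>))"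
      using Q_robust_bounds[OF assms(1)] by (intro sum_mono) simp
    finally have "norm (Qr \<pi> $ s) \<le> CARD('a) / (1 - \<gamma>)"
      by simp
    moreover have "norm (\<pi>' $ s - \<pi> $ s) \<le> norm (\<pi>' - \<pi>)"
      using Finite_Cartesian_Product.norm_nth_le[of "\<pi>' - \<pi>" s] by simp
    ultimately have "norm (Qr \<pi> $ s) * norm (\<pi>' $ s - \<pi> $ s) \<le> ?C"
      using discount by (intro mult_mono) auto
    then show ?thesis
      using norm_cauchy_schwarz order_trans by blast
  qed
  then have "G (\<lambda>s. Qr \<pi> $ s \<bullet> (\<pi>' $ s - \<pi> $ s)) s \<le> ?C / (1 - \<gamma>)"
    using G_mono[of "\<lambda>s. Qr \<pi> $ s \<bullet> (\<pi>' $ s - \<pi> $ s)" "\<lambda>_. ?C" s] by (simp add: G_const)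
  then show ?thesis
    using V_robust_diff_le[OF assms, of s] by (simp add: power2_eq_square)
qed

text \<open>Using the worst kernel of \<open>\<pi>'\<close> on both sides, exactly for
  \<open>\<pi>'\<close> and as a lower bound for \<open>\<pi>\<close>, leaves a discounted average
  of value differences.\<close>

lemma Q_robust_lipschitz:
  assumes "\<pi> \<in> policies" "\<pi>' \<in> policies"
  shows "Qr \<pi>' $ s $ a - Qr \<pi> $ s $ a \<le> CARD('a) / (1 - \<gamma>)\<^sup>2 * norm (\<pi>' - \<pi>)"
proof -
  interpret controlled_chain \<pi>' "PN + worst \<pi>'" \<gamma>
    by (intro chain worst_in_U assms)
  let ?L = "CARD('a) / (1 - \<gamma>)\<^sup>2 * norm (\<pi>' - \<pi>)" and ?P = "\<lambda>s'. (PN + worst \<pi>') $ s $ a $ s'"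
  have "Qr \<pi>' $ s $ a = c s a + \<gamma> * (\<Sum>s'\<in>UNIV. ?P s' * Vr \<pi>' s')"
    by (rule Q_robust_worst[OF assms(2)])
  moreover have "c s a + \<gamma> * (\<Sum>s'\<in>UNIV. ?P s' * Vr \<pi> s') \<le> Qr \<pi> $ s $ a"
    by (intro Q_robust_ge worst_in_U assms)
  ultimately have "Qr \<pi>' $ s $ a - Qr \<pi> $ s $ a \<le> \<gamma> * (\<Sum>s'\<in>UNIV. ?P s' * (Vr \<pi>' s' - Vr \<pi> s'))"
    by (simp add: right_diff_distrib sum_subtractf)
  also have "\<dots> \<le> \<gamma> * (\<Sum>s'\<in>UNIV. ?P s' * ?L)"
    using discount by (intro mult_left_mono sum_mono kernelD V_robust_lipschitz assms) auto
  also have "\<dots> = \<gamma> * ?L"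
    using kernelD(3)[of s a] by (simp only: sum_distrib_right[symmetric] mult_1)
  also have "\<dots> \<le> ?L"
    using discount mult_right_mono[of \<gamma> 1 ?L] by simp
  finally show ?thesis .
qed

lemma continuous_on_Q_robust: "continuous_on policies Qr"
proof -
  have "continuous_on policies (\<lambda>\<pi>. Qr \<pi> $ s $ a)" for s a
  proof (rule lipschitz_on_continuous_on, rule lipschitz_onI)
    fix \<pi> \<pi>' :: "real^'a^'s"
    assume "\<pi> \<in> policies" "\<pi>' \<in> policies"
    then show "dist (Qr \<pi> $ s $ a) (Qr \<pi>' $ s $ a) \<le> CARD('a) / (1 - \<gamma>)\<^sup>2 * dist \<pi> \<pi>'"
      using Q_robust_lipschitz[of \<pi> \<pi>' s a] Q_robust_lipschitz[of \<pi>' \<pi> s a]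
      by (simp add: dist_norm norm_minus_commute abs_le_iff)
  qed simp
  then have "continuous_on policies (\<lambda>\<pi>. \<chi> s a. Qr \<pi> $ s $ a)"
    by (intro continuous_on_vec_lambda)
  then show ?thesis
    by simp
qed

text \<open>The bound along one realization, in terms of the actual estimation errors, so that only
  expectations remain to be taken.\<close>

lemma srpmd_bound:
  assumes \<rho>: "\<rho> \<in> prob_simplex" and opt: "optimal_robust c \<gamma> PN U p"
    and M: "mismatch \<gamma> PN U p \<rho> < \<infinity>" "M = enn2real (mismatch \<gamma> PN U p \<rho>)"
    and M': "mismatch' \<gamma> PN U p \<rho> < \<infinity>" "M' = enn2real (mismatch' \<gamma> PN U p \<rho>)"
    and init: "\<pi>0 \<in> policies"
    and D\<^sub>w: "bdd_above (bregman_values w g0 \<pi>0)" "D\<^sub>w = Sup (bregman_values w g0 \<pi>0)"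
    and \<eta>: "\<And>k. 0 < \<eta> k"
    and stepsize: "\<And>k. 1 \<le> k \<Longrightarrow> \<eta> k \<ge> \<eta> (k - 1) * inverse (1 - (1 - \<gamma>) / M) * M'"
    and path: "srpmd_path w \<eta> \<pi>0 g0 Qe \<pi> g"
  shows "f \<rho> (\<pi> k) - f \<rho> p \<le> (1 - (1 - \<gamma>) / M) ^ k * (f \<rho> \<pi>0 - f \<rho> p)
    + (1 - (1 - \<gamma>) / M) powi (int k - 1) * (D\<^sub>w / (M * \<eta> 0))
    + 4 / (1 - \<gamma>) * (\<Sum>t<k. (1 - (1 - \<gamma>) / M) ^ (k - t - 1) * infnorm (Qe t - Qr (\<pi> t)))"
proof -
  define q where "q = 1 - (1 - \<gamma>) / M"
  define e where "e t = infnorm (Qe t - Qr (\<pi> t))" for t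
  define B where "B k s = bregman w (g k $ s) (p $ s) (\<pi> k $ s)" for k s
  define d where "d k = visit_from \<gamma> (PN + worst (\<pi> k)) p \<rho>" for k
  have p: "p \<in> policies"
    using opt by (simp add: optimal_robust_def)
  have \<pi>: "\<pi> k \<in> policies" for k
    by (rule srpmd_in_policies[OF path \<eta> init])
  have \<pi>0: "\<pi> 0 = \<pi>0" "g 0 = g0"
    using path by (auto simp: srpmd_path_def)
  have M1: "1 \<le> M"
    unfolding M(2) by (intro mismatch_ge_1 p \<rho> M)
  then have q: "0 < q"
    using discount by (simp add: q_def field_simps)
  have B0: "0 \<le> B k s" for k s
    unfolding B_def by (rule srpmd_bregman_nonneg[OF path \<eta>])
  have d0: "0 \<le> d k s" for k s
    unfolding d_def by (intro controlled_chain.visit_from_nonneg[OF chain] p worst_in_U \<pi> \<rho>)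
  have sum_d: "(\<Sum>s\<in>UNIV. d k s) = 1" for k
    unfolding d_def by (intro controlled_chain.sum_visit_from_1[OF chain] p worst_in_U \<pi> \<rho>)
  have e0: "0 \<le> e t" for t
    by (simp add: e_def infnorm_pos_le)
  have B_le: "B 0 s \<le> D\<^sub>w" for s
    unfolding B_def \<pi>0 D\<^sub>w(2) using p by (intro cSup_upper D\<^sub>w(1)) (auto simp: bregman_values_def)
  then have D0: "0 \<le> D\<^sub>w"
    using B0 order_trans by blast
  show ?thesis
  proof (cases k)
    case 0
    \<comment> \<open>At \<open>k = 0\<close> the exponent in \<open>powi\<close> is
      \<open>-1\<close> and the error sum is empty, so the claim only needs this term to be
      nonnegative.\<close>
    have "0 \<le> q powi (- 1) * (D\<^sub>w / (M * \<eta> 0))"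
      using q D0 M1 \<eta>[of 0] by simp
    with 0 show ?thesis
      by (simp add: \<pi>0 q_def)
  next
    case (Suc n)
    have q_scale: "(M - (1 - \<gamma>)) * x / M = q * x" for x
      using M1 by (simp add: q_def field_simps)
    \<comment> \<open>\<open>mirror_step\<close> divided by \<open>M\<close>, with the decrease of
      the divergence from the iterate to \<open>p\<close> as \<open>\<Delta>\<close>; the
      nonnegative divergence between consecutive iterates is dropped.\<close>
    have step: "(f \<rho> (\<pi> (Suc k)) - f \<rho> p) + (\<Sum>s\<in>UNIV. d k s * B (Suc k) s) / (M * \<eta> k)
        \<le> q * (f \<rho> (\<pi> k) - f \<rho> p) + (\<Sum>s\<in>UNIV. d k s * B k s) / (M * \<eta> k) + 2 * e k / (1 - \<gamma>)" for k
    proof -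
      have "(1 - \<gamma>) * (f \<rho> (\<pi> k) - f \<rho> p)
          \<le> M * (f \<rho> (\<pi> k) - f \<rho> (\<pi> (Suc k))) + 2 * M * e k / (1 - \<gamma>)
            + (\<Sum>s\<in>UNIV. visit_from \<gamma> (PN + worst (\<pi> k)) p \<rho> s * (B k s - B (Suc k) s)) / \<eta> k"
      proof (rule mirror_step[OF \<pi> \<pi> p \<rho> \<eta>])
        show "0 \<le> M" using M1 by simp
        show "visit_from \<gamma> (PN + worst (\<pi> k)) p \<rho> s \<le> M * \<rho> $ s" for s
          unfolding M(2) by (intro visit_le_mismatch p \<rho> worst_in_U \<pi> M)
        show "\<bar>(Qe k - Qr (\<pi> k)) $ s $ a\<bar> \<le> e k" for s a
          unfolding e_def by (rule abs_nth_le_infnorm)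
        show "Qe k $ s \<bullet> (\<pi> (Suc k) $ s - \<pi> k $ s) \<le> 0" for s
          by (rule srpmd_descent[OF path \<eta> init])
        have "p $ s \<in> prob_simplex" for s
          using p by (simp add: policies_def)
        then show "\<eta> k * (Qe k $ s \<bullet> (\<pi> (Suc k) $ s - p $ s)) \<le> B k s - B (Suc k) s" for s
          using srpmd_three_point[OF path \<eta>, of "p $ s" k s]
            srpmd_bregman_nonneg[OF path \<eta>, of k s "\<pi> (Suc k) $ s"]
          by (simp add: B_def)
      qed
      then have "M * (f \<rho> (\<pi> (Suc k)) - f \<rho> p) + (\<Sum>s\<in>UNIV. d k s * B (Suc k) s) / \<eta> k
          \<le> (M - (1 - \<gamma>)) * (f \<rho> (\<pi> k) - f \<rho> p) + (\<Sum>s\<in>UNIV. d k s * B k s) / \<eta> k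
            + M * (2 * e k / (1 - \<gamma>))"
        unfolding d_def[symmetric]
        by (simp add: algebra_simps sum_subtractf diff_divide_distrib)
      then have "(M * (f \<rho> (\<pi> (Suc k)) - f \<rho> p) + (\<Sum>s\<in>UNIV. d k s * B (Suc k) s) / \<eta> k) / M
          \<le> ((M - (1 - \<gamma>)) * (f \<rho> (\<pi> k) - f \<rho> p) + (\<Sum>s\<in>UNIV. d k s * B k s) / \<eta> k
            + M * (2 * e k / (1 - \<gamma>))) / M"
        using M1 by (intro divide_right_mono) auto
      then show ?thesis
        using M1 by (simp add: add_divide_distrib mult.commute[of M "\<eta> k"] q_scale)
    qed
    \<comment> \<open>Only the weights move, from the worst kernel of \<open>\<pi> k\<close> to that
      of \<open>\<pi> (Suc k)\<close>; the divergences stay fixed.\<close>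
    have change: "(\<Sum>s\<in>UNIV. d (Suc k) s * B (Suc k) s) \<le> M' * (\<Sum>s\<in>UNIV. d k s * B (Suc k) s)" for k
    proof -
      have "d (Suc k) s * B (Suc k) s \<le> (M' * d k s) * B (Suc k) s" for s
        unfolding d_def M'(2) by (intro mult_right_mono visit_le_mismatch' p \<rho> worst_in_U \<pi> M' B0)
      then show ?thesis
        by (simp add: sum_distrib_left mult.assoc sum_mono)
    qed
    have stepsize': "M' * \<eta> k \<le> q * \<eta> (Suc k)" for k
      using stepsize[of "Suc k"] q by (simp add: q_def[symmetric] field_simps)
    have \<psi>0: "0 \<le> (\<Sum>s\<in>UNIV. d k s * B (Suc k) s)" for k
      by (intro sum_nonneg mult_nonneg_nonneg d0 B0)
    have "(\<Sum>s\<in>UNIV. d 0 s * B 0 s) \<le> (\<Sum>s\<in>UNIV. d 0 s * D\<^sub>w)"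
      by (intro sum_mono mult_left_mono B_le d0)
    also have "\<dots> = D\<^sub>w"
      by (simp add: sum_distrib_right[symmetric] sum_d)
    finally have \<phi>0: "(\<Sum>s\<in>UNIV. d 0 s * B 0 s) / (M * \<eta> 0) \<le> D\<^sub>w / (M * \<eta> 0)"
      using M1 \<eta>[of 0] by (intro divide_right_mono) auto
    have "f \<rho> (\<pi> (Suc n)) - f \<rho> p
        \<le> (f \<rho> (\<pi> (Suc n)) - f \<rho> p) + (\<Sum>s\<in>UNIV. d n s * B (Suc n) s) / (M * \<eta> n)"
      using \<psi>0[of n] M1 \<eta>[of n] by simp
    also have "\<dots> \<le> q ^ Suc n * (f \<rho> (\<pi> 0) - f \<rho> p)
        + q ^ n * ((\<Sum>s\<in>UNIV. d 0 s * B 0 s) / (M * \<eta> 0))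
        + (\<Sum>t<Suc n. q ^ (n - t) * (2 * e t / (1 - \<gamma>)))"
      by (rule contraction_unroll[where M'=M' and \<phi>="\<lambda>k. \<Sum>s\<in>UNIV. d k s * B k s"
            and \<psi>="\<lambda>k. \<Sum>s\<in>UNIV. d k s * B (Suc k) s" and a="\<lambda>k. f \<rho> (\<pi> k) - f \<rho> p"
            and \<epsilon>="\<lambda>k. 2 * e k / (1 - \<gamma>)"])
        (use q M1 \<eta> \<psi>0 step change stepsize' in auto)
    \<comment> \<open>The unrolled contraction carries the constant 2, enlarged here to the 4 of the
      claim; \<open>n - t\<close> is \<open>k - t - 1\<close>.\<close>
    also have "\<dots> \<le> q ^ Suc n * (f \<rho> (\<pi> 0) - f \<rho> p) + q ^ n * (D\<^sub>w / (M * \<eta> 0))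
        + (\<Sum>t<Suc n. q ^ (n - t) * (4 * e t / (1 - \<gamma>)))"
      using q e0 discount
      by (intro add_mono mult_left_mono sum_mono \<phi>0 divide_right_mono order_refl) auto
    also have "(\<Sum>t<Suc n. q ^ (n - t) * (4 * e t / (1 - \<gamma>)))
        = 4 / (1 - \<gamma>) * (\<Sum>t<Suc n. q ^ (Suc n - t - 1) * e t)"
      by (simp add: sum_distrib_left mult_ac del: sum.lessThan_Suc)
    finally show ?thesis
      unfolding Suc q_def[symmetric] e_def[symmetric] \<pi>0(1)[symmetric]
      by (simp del: sum.lessThan_Suc power_Suc)
  qed
qed

end

section \<open>Expectations\<close>

lemma subalgebra_past:
  assumes "\<And>k. \<xi> k \<in> \<Omega> \<rightarrow>\<^sub>M X k"
  shows "subalgebra \<Omega> (past \<Omega> X \<xi> k)"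
proof -
  have "(\<lambda>\<omega>. \<lambda>i\<in>{..<k}. \<xi> i \<omega>) \<in> \<Omega> \<rightarrow>\<^sub>M PiM {..<k} X"
    by (intro measurable_restrict assms)
  then show ?thesis
    unfolding subalgebra_def past_def by (simp add: sets_image_in_sets)
qed

text \<open>The tower property, with the constant 1 as test function.\<close>

lemma nn_integral_le_of_nn_cond_exp_le:
  assumes "prob_space M" "subalgebra M F" "g \<in> borel_measurable M"
    and "AE x in M. nn_cond_exp M F g x \<le> k"
  shows "(\<integral>\<^sup>+x. g x \<partial>M) \<le> k"
proof -
  interpret prob_space M by fact
  interpret finite_measure_subalgebra M F
    by unfold_locales fact
  have "(\<integral>\<^sup>+x. g x \<partial>M) = (\<integral>\<^sup>+x. nn_cond_exp M F g x \<partial>M)"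
    using nn_cond_exp_intg[of "\<lambda>_. 1" g] assms(3) by simp
  also have "\<dots> \<le> (\<integral>\<^sup>+x. k \<partial>M)"
    by (rule nn_integral_mono_AE) fact
  finally show ?thesis
    by (simp add: emeasure_space_1)
qed

text \<open>Integrability is recorded as well, because the Bochner integral of a non-integrable
  error would be 0 by default.\<close>

lemma est_error_le_integral:
  fixes Qe Q :: "'w \<Rightarrow> real^'a::finite^'s::finite"
  assumes "prob_space \<Omega>" "subalgebra \<Omega> F"
    and "Qe \<in> borel_measurable \<Omega>" "Q \<in> borel_measurable \<Omega>" "est_error_le \<Omega> F Qe Q e"
  shows "integrable \<Omega> (\<lambda>\<omega>. infnorm (Qe \<omega> - Q \<omega>))" "(\<integral>\<omega>. infnorm (Qe \<omega> - Q \<omega>) \<partial>\<Omega>) \<le> e"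
proof -
  have e: "0 \<le> e"
    and AE: "AE \<omega> in \<Omega>. nn_cond_exp \<Omega> F (\<lambda>\<omega>. ennreal (infnorm (Qe \<omega> - Q \<omega>))) \<omega> \<le> ennreal e"
    using assms(5) by (auto simp: est_error_le_def)
  have "infnorm \<in> borel_measurable (borel :: (real^'a^'s) measure)"
    by (intro borel_measurable_continuous_onI continuous_on_infnorm continuous_on_id)
  then have m: "(\<lambda>\<omega>. infnorm (Qe \<omega> - Q \<omega>)) \<in> borel_measurable \<Omega>"
    by (rule measurable_compose[rotated]) (intro borel_measurable_diff assms)
  have le: "(\<integral>\<^sup>+\<omega>. ennreal (infnorm (Qe \<omega> - Q \<omega>)) \<partial>\<Omega>) \<le> ennreal e"
    using m by (intro nn_integral_le_of_nn_cond_exp_le[OF assms(1,2) _ AE]) simp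
  show int: "integrable \<Omega> (\<lambda>\<omega>. infnorm (Qe \<omega> - Q \<omega>))"
    using m le by (intro integrableI_nonneg) (auto simp: infnorm_pos_le le_less_trans)
  show "(\<integral>\<omega>. infnorm (Qe \<omega> - Q \<omega>) \<partial>\<Omega>) \<le> e"
    using le e by (subst (asm) nn_integral_eq_integral[OF int])
      (auto simp: infnorm_pos_le ennreal_le_iff)
qed

theorem theorem4p1:
  fixes c :: "'s::finite \<Rightarrow> 'a::finite \<Rightarrow> real"
    and \<gamma> :: real
    and PN :: "real^'s^'a^'s"
    and U :: "(real^'s^'a^'s) set"
    and \<rho> :: "real^'s"
    and \<pi>_opt \<pi>0 g0 :: "real^'a^'s"
    and M M' D\<^sub>w :: real
    and w :: "real^'a \<Rightarrow> real"
    and \<eta> :: "nat \<Rightarrow> real"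
    and \<Omega> :: "'w measure"
    and X :: "nat \<Rightarrow> 'x measure"
    and \<xi> :: "nat \<Rightarrow> 'w \<Rightarrow> 'x"
    and Qhat :: "nat \<Rightarrow> real^'a^'s \<Rightarrow> 'x \<Rightarrow> real^'a^'s"
    and \<pi> g :: "nat \<Rightarrow> 'w \<Rightarrow> real^'a^'s"
  assumes cost: "\<And>s a. 0 < c s a \<and> c s a \<le> 1"
    and discount: "0 < \<gamma>" "\<gamma> < 1"
    and nominal: "PN \<in> kernels"
    and uncertainty: "U \<noteq> {}" "compact U" "rectangular U" "\<And>u. u \<in> U \<Longrightarrow> PN + u \<in> kernels"
    and rho: "\<rho> \<in> prob_simplex"
    and opt: "optimal_robust c \<gamma> PN U \<pi>_opt"
    and M: "mismatch \<gamma> PN U \<pi>_opt \<rho> < \<infinity>" "M = enn2real (mismatch \<gamma> PN U \<pi>_opt \<rho>)"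
    and M': "mismatch' \<gamma> PN U \<pi>_opt \<rho> < \<infinity>" "M' = enn2real (mismatch' \<gamma> PN U \<pi>_opt \<rho>)"
    and w: "strictly_convex w"
    and init: "\<pi>0 \<in> policies"
    and D\<^sub>w: "bdd_above (bregman_values w g0 \<pi>0)" "D\<^sub>w = Sup (bregman_values w g0 \<pi>0)"
    and stepsize_pos: "\<And>k. 0 < \<eta> k"
    and stepsize: "\<And>k. 1 \<le> k \<Longrightarrow> \<eta> k \<ge> \<eta> (k - 1) * inverse (1 - (1 - \<gamma>) / M) * M'"
    and \<Omega>: "prob_space \<Omega>"
    and samples: "\<And>k. \<xi> k \<in> \<Omega> \<rightarrow>\<^sub>M X k"
    and estimates: "\<And>k. (\<lambda>\<omega>. Qhat k (\<pi> k \<omega>) (\<xi> k \<omega>)) \<in> borel_measurable \<Omega>"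
    and adapted: "\<And>k. \<pi> k \<in> borel_measurable (past \<Omega> X \<xi> k)"
    and srpmd: "\<And>\<omega>. \<omega> \<in> space \<Omega> \<Longrightarrow>
      srpmd_path w \<eta> \<pi>0 g0 (\<lambda>k. Qhat k (\<pi> k \<omega>) (\<xi> k \<omega>)) (\<lambda>k. \<pi> k \<omega>) (\<lambda>k. g k \<omega>)"
  shows
    "(\<forall>e :: nat \<Rightarrow> real.
        (\<forall>k. est_error_le \<Omega> (past \<Omega> X \<xi> k) (\<lambda>\<omega>. Qhat k (\<pi> k \<omega>) (\<xi> k \<omega>))
               (\<lambda>\<omega>. Q_robust c \<gamma> PN U (\<pi> k \<omega>)) (e k)) \<longrightarrow>
        (\<forall>k. (\<integral>\<omega>. f_obj c \<gamma> PN U \<rho> (\<pi> k \<omega>) - f_obj c \<gamma> PN U \<rho> \<pi>_opt \<partial>\<Omega>)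
           \<le> (1 - (1 - \<gamma>) / M) ^ k * (f_obj c \<gamma> PN U \<rho> \<pi>0 - f_obj c \<gamma> PN U \<rho> \<pi>_opt)
             + (1 - (1 - \<gamma>) / M) powi (int k - 1) * (D\<^sub>w / (M * \<eta> 0))
             + 4 / (1 - \<gamma>) * (\<Sum>t<k. (1 - (1 - \<gamma>) / M) ^ (k - t - 1) * e t)))
     \<and>
     (\<forall>e :: real.
        (\<forall>k. est_error_le \<Omega> (past \<Omega> X \<xi> k) (\<lambda>\<omega>. Qhat k (\<pi> k \<omega>) (\<xi> k \<omega>))
               (\<lambda>\<omega>. Q_robust c \<gamma> PN U (\<pi> k \<omega>)) e) \<longrightarrow>
        (\<forall>k. (\<integral>\<omega>. f_obj c \<gamma> PN U \<rho> (\<pi> k \<omega>) - f_obj c \<gamma> PN U \<rho> \<pi>_opt \<partial>\<Omega>)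
           \<le> (1 - (1 - \<gamma>) / M) ^ k * (f_obj c \<gamma> PN U \<rho> \<pi>0 - f_obj c \<gamma> PN U \<rho> \<pi>_opt)
             + (1 - (1 - \<gamma>) / M) powi (int k - 1) * (D\<^sub>w / (M * \<eta> 0))
             + 4 * M * e / (1 - \<gamma>)\<^sup>2))"
proof -
  interpret robust_mdp c \<gamma> PN U
    using cost discount uncertainty by unfold_locales (auto intro: less_imp_le)
  define q where "q = 1 - (1 - \<gamma>) / M"
  define err where "err t \<omega> = infnorm (Qhat t (\<pi> t \<omega>) (\<xi> t \<omega>) - Qr (\<pi> t \<omega>))" for t \<omega>
  define A where "A k = q ^ k * (f \<rho> \<pi>0 - f \<rho> \<pi>_opt) + q powi (int k - 1) * (D\<^sub>w / (M * \<eta> 0))" for k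
  have p: "\<pi>_opt \<in> policies"
    using opt by (simp add: optimal_robust_def)
  have M1: "1 \<le> M"
    unfolding M(2) by (intro mismatch_ge_1 p rho M)
  have q: "0 < q" "q < 1"
    using M1 discount by (simp_all add: q_def field_simps)
  have policies: "\<pi> k \<omega> \<in> policies" if "\<omega> \<in> space \<Omega>" for k \<omega>
    by (rule srpmd_in_policies[OF srpmd[OF that] stepsize_pos init])
  have sub: "subalgebra \<Omega> (past \<Omega> X \<xi> k)" for k
    by (rule subalgebra_past[OF samples])
  \<comment> \<open>Continuity of \<open>Qr\<close> is known on \<open>policies\<close>, so
    \<open>\<pi> k\<close> is first made a measurable map into that subspace.\<close>
  have Q_meas: "(\<lambda>\<omega>. Qr (\<pi> k \<omega>)) \<in> borel_measurable \<Omega>" for k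
  proof (rule measurable_compose[where f="\<pi> k" and g=Qr])
    show "\<pi> k \<in> \<Omega> \<rightarrow>\<^sub>M restrict_space borel policies"
      using measurable_from_subalg[OF sub adapted] policies by (intro measurable_restrict_space2) auto
    show "Qr \<in> borel_measurable (restrict_space borel policies)"
      by (intro borel_measurable_continuous_on_restrict continuous_on_Q_robust)
  qed
  have bound: "f \<rho> (\<pi> k \<omega>) - f \<rho> \<pi>_opt \<le> A k + 4 / (1 - \<gamma>) * (\<Sum>t<k. q ^ (k - t - 1) * err t \<omega>)"
    if "\<omega> \<in> space \<Omega>" for k \<omega>
    unfolding A_def q_def err_def
    by (rule srpmd_bound[OF rho opt M M' init D\<^sub>w stepsize_pos stepsize srpmd[OF that]])
  have opt_le: "0 \<le> f \<rho> (\<pi> k \<omega>) - f \<rho> \<pi>_opt" if "\<omega> \<in> space \<Omega>" for k \<omega>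
    using opt policies[OF that] rho unfolding f_obj_def
    by (auto simp: optimal_robust_def prob_simplex_def intro!: sum_mono mult_left_mono)
  have main: "(\<integral>\<omega>. f \<rho> (\<pi> k \<omega>) - f \<rho> \<pi>_opt \<partial>\<Omega>)
      \<le> A k + 4 / (1 - \<gamma>) * (\<Sum>t<k. q ^ (k - t - 1) * e t)"
    if e: "\<forall>k. est_error_le \<Omega> (past \<Omega> X \<xi> k) (\<lambda>\<omega>. Qhat k (\<pi> k \<omega>) (\<xi> k \<omega>)) (\<lambda>\<omega>. Qr (\<pi> k \<omega>)) (e k)"
    for e k
  proof -
    interpret \<Omega>: prob_space \<Omega> by (rule \<Omega>)
    have int: "integrable \<Omega> (err t)" and le: "(\<integral>\<omega>. err t \<omega> \<partial>\<Omega>) \<le> e t" for t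
      unfolding err_def[abs_def]
      by (rule est_error_le_integral[OF \<Omega> sub estimates Q_meas e[rule_format]])+
    have "(\<integral>\<omega>. f \<rho> (\<pi> k \<omega>) - f \<rho> \<pi>_opt \<partial>\<Omega>)
        \<le> (\<integral>\<omega>. A k + 4 / (1 - \<gamma>) * (\<Sum>t<k. q ^ (k - t - 1) * err t \<omega>) \<partial>\<Omega>)"
    \<comment> \<open>The majorant must be integrable and nonnegative; the latter holds because it
      lies above the gap, which is nonnegative by optimality.\<close>
    proof (rule integral_mono')
      show "integrable \<Omega> (\<lambda>\<omega>. A k + 4 / (1 - \<gamma>) * (\<Sum>t<k. q ^ (k - t - 1) * err t \<omega>))"
        by (intro Bochner_Integration.integrable_add integrable_mult_right Bochner_Integration.integrable_sum
            int \<Omega>.integrable_const)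
    qed (use bound opt_le order_trans in blast)+
    also have "\<dots> = A k + 4 / (1 - \<gamma>) * (\<Sum>t<k. q ^ (k - t - 1) * (\<integral>\<omega>. err t \<omega> \<partial>\<Omega>))"
      by (simp add: int \<Omega>.prob_space)
    also have "\<dots> \<le> A k + 4 / (1 - \<gamma>) * (\<Sum>t<k. q ^ (k - t - 1) * e t)"
      using discount q by (intro add_left_mono mult_left_mono sum_mono le) auto
    finally show ?thesis .
  qed
  \<comment> \<open>Reversing the sum gives a geometric one, at most
    \<open>1 / (1 - q) = M / (1 - \<gamma>)\<close>.\<close>
  have geometric: "4 / (1 - \<gamma>) * (\<Sum>t<k. q ^ (k - t - 1) * e) \<le> 4 * M * e / (1 - \<gamma>)\<^sup>2"
    if "0 \<le> e" for e k
  proof -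
    have "(\<Sum>t<k. q ^ (k - t - 1)) = (\<Sum>t<k. q ^ t)"
      using sum.nat_diff_reindex[of "\<lambda>t. q ^ t" k] by simp
    also have "\<dots> \<le> 1 / (1 - q)"
      using q by (simp add: sum_gp_strict divide_right_mono)
    also have "\<dots> = M / (1 - \<gamma>)"
      by (simp add: q_def)
    finally have "4 / (1 - \<gamma>) * ((\<Sum>t<k. q ^ (k - t - 1)) * e) \<le> 4 / (1 - \<gamma>) * (M / (1 - \<gamma>) * e)"
      using that discount by (intro mult_left_mono mult_right_mono) auto
    then show ?thesis
      unfolding sum_distrib_right[symmetric] by (simp add: power2_eq_square mult_ac)
  qed
  have "(\<integral>\<omega>. f \<rho> (\<pi> k \<omega>) - f \<rho> \<pi>_opt \<partial>\<Omega>) \<le> A k + 4 * M * e / (1 - \<gamma>)\<^sup>2"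
    if "\<forall>k. est_error_le \<Omega> (past \<Omega> X \<xi> k) (\<lambda>\<omega>. Qhat k (\<pi> k \<omega>) (\<xi> k \<omega>)) (\<lambda>\<omega>. Qr (\<pi> k \<omega>)) e"
    for e k
    using main[of "\<lambda>_. e" k] geometric[of e k] that by (auto simp: est_error_le_def)
  with main show ?thesis
    unfolding A_def q_def by blast
qed

end
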